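(* Let $F=F_n$ be the free group of rank $n\ge 3$ freely generated by $x_1,\dots,x_n$, let $R$ be the normal closure in $F$ of $Y=\{[x_1,x_2],x_3\}$, and let $M=F/[R,R]$. Then in $M$ there are infinitely many 2-element sets which are pairwise AC-inequivalent but stably AC-equivalent, and each of which has the same normal closure in $M$, namely (the image of) $R$. A particular pair of elements of $M$ with the same normal closure as $Y$ but AC-inequivalent to $Y$ is $$\Big\{\,[x_1,x_2]\,[x_1,x_2,x_1]^{-2x_2^{-1}}\cdot x_3^{4x_2^{-1}},\quad [x_1,x_2,x_1,x_1]^{-x_2^{-1}}\cdot x_3\,[x_3,x_1]^{2x_2^{-1}}\,\Big\}.$$
   Context: Elements of $F$ and their images in $M$ are denoted by the same letters. Commutators: $[a,b]=aba^{-1}b^{-1}$, left-normed: $[a,b,c]=[[a,b],c]$, $[a,b,c,d]=[[[a,b],c],d]$. For $r$ in the image $R/[R,R]$ of $R$ in $M$, an integer $k$ and a group element $g$, the exponential notation $r^{kg}$ means $g^{-1}r^kg$ (so $r^{-g}=g^{-1}r^{-1}g$). AC-equivalence in a group $G$: for a tuple $(y_1,\dots,y_m)$ of elements of $G$, consider (AC1) replace $y_i$ by $y_iy_j$ for some $j\neq i$; (AC2) replace $y_i$ by $y_i^{-1}$; (AC3) replace $y_i$ by $gy_ig^{-1}$ for some $g\in G$ (all other entries unchanged). Two tuples (or finite sets, listed as tuples) are AC-equivalent in $G$ if one is obtained from the other by a finite sequence of such transformations. Stable AC-equivalence in $M=F/[R,R]$: in addition one allows (AC4) adjoining a new free generator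 $x_\nu$ to the tuple, and (AC5) the converse. Here adjoining $x_\nu$ replaces $F$ by $\widetilde F=F*\langle x_\nu\rangle$, $R$ by the normal closure $\widetilde R$ of $R\cup\{x_\nu\}$ in $\widetilde F$, and $M$ by $\widetilde F/[\widetilde R,\widetilde R]$. Thus two tuples of the same length are stably AC-equivalent if, after adjoining the same finite number of new free generators to both, they can be connected by transformations (AC1)-(AC3) in the correspondingly enlarged group, possibly with further uses of (AC4) and (AC5). *)

theory Defs
  imports "HOL-Algebra.Algebra"
begin

section \<open>Free groups\<close>

text \<open>A letter \<^term>\<open>(a, True)\<close> stands for the generator \<open>a\<close> and \<^term>\<open>(a, False)\<close> for its inverse.
  Since elements are reduced words, the free group on a subset of \<open>S\<close> is literally a subgroup of
  the free group on \<open>S\<close>.\<close>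

type_synonym 'a letter = "'a \<times> bool"
type_synonym 'a word = "'a letter list"

definition cancelling :: "'a letter \<Rightarrow> 'a letter \<Rightarrow> bool" where
  "cancelling a b \<longleftrightarrow> fst a = fst b \<and> snd a \<noteq> snd b"

definition reduced :: "'a word \<Rightarrow> bool" where
  "reduced w \<longleftrightarrow> successively (\<lambda>a b. \<not> cancelling a b) w"

fun lmult :: "'a letter \<Rightarrow> 'a word \<Rightarrow> 'a word" where
  "lmult a [] = [a]"
| "lmult a (b # w) = (if cancelling a b then w else a # b # w)"

definition free_group :: "'a set \<Rightarrow> 'a word monoid" where
  "free_group S =
     \<lparr>carrier = {w. reduced w \<and> fst ` set w \<subseteq> S}, monoid.mult = (\<lambda>u v. foldr lmult u v), one = []\<rparr>"

definition gen :: "'a \<Rightarrow> 'a word" where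
  "gen a = [(a, True)]"

lemma reduced_lmult: "reduced w \<Longrightarrow> reduced (lmult a w)"
  by (cases w) (auto simp: reduced_def successively_Cons)

lemma lmult_reduced: "reduced (a # w) \<Longrightarrow> lmult a w = a # w"
  by (cases w) (auto simp: reduced_def)

lemma lmult_cancel:
  assumes "cancelling a b" "reduced w"
  shows "lmult a (lmult b w) = w"
  using assms
  by (cases w rule: remdups_adj.cases)
    (auto simp: reduced_def cancelling_def prod_eq_iff split: if_splits)

lemma set_lmult: "set (lmult a w) \<subseteq> insert a (set w)"
  by (cases w) auto

lemma reduced_foldr: "reduced v \<Longrightarrow> reduced (foldr lmult u v)"
  by (induction u) (auto intro: reduced_lmult)

lemma set_foldr_lmult: "set (foldr lmult u v) \<subseteq> set u \<union> set v"
  by (induction u) (use set_lmult in fastforce)+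

lemma foldr_lmult_lmult:
  "reduced w \<Longrightarrow> foldr lmult (lmult a u) w = lmult a (foldr lmult u w)"
  by (cases u) (auto simp: lmult_cancel reduced_foldr)

lemma foldr_lmult_assoc:
  "reduced w \<Longrightarrow> foldr lmult (foldr lmult u v) w = foldr lmult u (foldr lmult v w)"
  by (induction u) (auto simp: foldr_lmult_lmult)

lemma foldr_lmult_Nil: "reduced u \<Longrightarrow> foldr lmult u [] = u"
proof (induction u)
  case (Cons a u)
  moreover from Cons.prems have "reduced u"
    by (auto simp: reduced_def successively_Cons)
  ultimately show ?case
    by (simp add: lmult_reduced)
qed simp

lemma foldr_lmult_inverse:
  "reduced v \<Longrightarrow>
     foldr lmult (map (\<lambda>(a, e). (a, \<not> e)) (rev u)) (foldr lmult u v) = v"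
  by (induction u arbitrary: v)
    (auto simp: lmult_cancel cancelling_def reduced_foldr)

lemma group_free_group: "group (free_group S)"
proof (rule groupI)
  fix u assume u: "u \<in> carrier (free_group S)"
  let ?i = "map (\<lambda>(a, e). (a, \<not> e)) (rev u)"
  let ?v = "foldr lmult ?i []"
  have "fst ` set ?i = fst ` set u"
    by (force simp: image_iff)
  then have "fst ` set ?v \<subseteq> fst ` set u"
    using image_mono[OF set_foldr_lmult[of ?i "[]"], of fst] by simp
  then have "?v \<in> carrier (free_group S)"
    using u reduced_foldr[of "[]" ?i] by (auto simp: free_group_def reduced_def)
  moreover have "foldr lmult ?v u = []"
    using u foldr_lmult_inverse[of "[]" u]
    by (simp add: free_group_def foldr_lmult_assoc foldr_lmult_Nil reduced_def)
  ultimately show "\<exists>v\<in>carrier (free_group S). v \<otimes>\<^bsub>free_group S\<^esub> u = \<one>\<^bsub>free_group S\<^esub>"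
    by (auto simp: free_group_def)
next
  fix u v assume "u \<in> carrier (free_group S)" "v \<in> carrier (free_group S)"
  then show "u \<otimes>\<^bsub>free_group S\<^esub> v \<in> carrier (free_group S)"
    using set_foldr_lmult[of u v] by (fastforce simp: free_group_def reduced_foldr)
qed (auto simp: free_group_def foldr_lmult_assoc, simp add: reduced_def)


section \<open>Commutators, exponents and normal closures\<close>

definition commutator :: "('a, 'b) monoid_scheme \<Rightarrow> 'a \<Rightarrow> 'a \<Rightarrow> 'a" where
  "commutator G a b = a \<otimes>\<^bsub>G\<^esub> b \<otimes>\<^bsub>G\<^esub> inv\<^bsub>G\<^esub> a \<otimes>\<^bsub>G\<^esub> inv\<^bsub>G\<^esub> b"

text \<open>The exponential notation \<open>r\<close> to the power \<open>k g\<close>.\<close>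

definition conj_pow :: "('a, 'b) monoid_scheme \<Rightarrow> 'a \<Rightarrow> int \<Rightarrow> 'a \<Rightarrow> 'a" where
  "conj_pow G r k g = inv\<^bsub>G\<^esub> g \<otimes>\<^bsub>G\<^esub> (r [^]\<^bsub>G\<^esub> k) \<otimes>\<^bsub>G\<^esub> g"

definition normal_closure :: "('a, 'b) monoid_scheme \<Rightarrow> 'a set \<Rightarrow> 'a set" where
  "normal_closure G A = \<Inter>{N. N \<lhd> G \<and> A \<subseteq> N}"


section \<open>AC-equivalence\<close>

inductive AC_move :: "('a, 'b) monoid_scheme \<Rightarrow> 'a list \<Rightarrow> 'a list \<Rightarrow> bool"
  for G :: "('a, 'b) monoid_scheme" where
  AC1: "i < length y \<Longrightarrow> j < length y \<Longrightarrow> j \<noteq> i \<Longrightarrow> AC_move G y (y[i := y ! i \<otimes>\<^bsub>G\<^esub> y ! j])"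
| AC2: "i < length y \<Longrightarrow> AC_move G y (y[i := inv\<^bsub>G\<^esub> (y ! i)])"
| AC3: "i < length y \<Longrightarrow> g \<in> carrier G \<Longrightarrow>
    AC_move G y (y[i := g \<otimes>\<^bsub>G\<^esub> y ! i \<otimes>\<^bsub>G\<^esub> inv\<^bsub>G\<^esub> g])"

definition AC_equivalent :: "('a, 'b) monoid_scheme \<Rightarrow> 'a list \<Rightarrow> 'a list \<Rightarrow> bool" where
  "AC_equivalent G = (AC_move G)\<^sup>*\<^sup>*"

definition listings :: "'a set \<Rightarrow> 'a list set" where
  "listings A = {y. distinct y \<and> set y = A}"


section \<open>Stable AC-equivalence\<close>

text \<open>The group \<open>M = F/[R,R]\<close> for the free group \<open>F\<close> on \<open>S\<close>, and the projection from \<open>F\<close> to \<open>M\<close>.\<close>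

definition quot_RR :: "'a set \<Rightarrow> 'a word set \<Rightarrow> 'a word set monoid" where
  "quot_RR S R = free_group S Mod derived (free_group S) R"

definition proj_RR :: "'a set \<Rightarrow> 'a word set \<Rightarrow> 'a word \<Rightarrow> 'a word set" where
  "proj_RR S R w = derived (free_group S) R #>\<^bsub>free_group S\<^esub> w"

text \<open>A state \<open>(S, R, y)\<close> records the generators of the current free group \<open>F\<close>, the current normal
  subgroup \<open>R\<close> of \<open>F\<close>, and the current tuple \<open>y\<close> in \<open>F/[R,R]\<close>.  The tuple is carried over to the
  enlarged group through a tuple \<open>ws\<close> of representatives in \<open>F\<close>; the choice of \<open>ws\<close> is immaterial.\<close>

inductive adjoin ::
  "'a set \<times> 'a word set \<times> 'a word set list \<Rightarrow> 'a set \<times> 'a word set \<times> 'a word set list \<Rightarrow> bool" where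
  "R \<lhd> free_group S \<Longrightarrow> v \<notin> S \<Longrightarrow> set ws \<subseteq> carrier (free_group S) \<Longrightarrow>
   R' = normal_closure (free_group (insert v S)) (insert (gen v) R) \<Longrightarrow>
   adjoin (S, R, map (proj_RR S R) ws)
          (insert v S, R', map (proj_RR (insert v S) R') (ws @ [gen v]))"

inductive stable_AC_move ::
  "'a set \<times> 'a word set \<times> 'a word set list \<Rightarrow> 'a set \<times> 'a word set \<times> 'a word set list \<Rightarrow> bool" where
  AC123: "AC_move (quot_RR S R) y z \<Longrightarrow> stable_AC_move (S, R, y) (S, R, z)"
| AC4: "adjoin s t \<Longrightarrow> stable_AC_move s t"
| AC5: "adjoin t s \<Longrightarrow> stable_AC_move s t"

definition stably_AC_equivalent ::
  "'a set \<Rightarrow> 'a word set \<Rightarrow> 'a word set list \<Rightarrow> 'a word set list \<Rightarrow> bool" where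
  "stably_AC_equivalent S R y z \<longleftrightarrow> stable_AC_move\<^sup>*\<^sup>* (S, R, y) (S, R, z)"

end

theory Submission
  imports Defs "HOL-Computational_Algebra.Formal_Laurent_Series" "HOL-Analysis.Determinants"
begin

text \<open>Write \<open>u = x\<^sub>1 - 1\<close> and \<open>y = x\<^sub>2\<close>. On pairs with entries in the relation module \<open>R/[R,R]\<close>,
  which is written additively, the matrix \<open>1 + k y N\<close> with \<open>N = (2, -u)\<^sup>T (u, 2)\<close> maps
  \<open>([x\<^sub>1, x\<^sub>2], x\<^sub>3)\<close> to a pair \<open>(p\<^sub>k, q\<^sub>k)\<close> with the same normal closure, and \<open>(p\<^sub>1, q\<^sub>1)\<close> is the
  pair of the theorem. As \<open>N\<close> is the product of a column and a row whose scalar product vanishes,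
  these matrices become products of elementary ones after adding one generator; this gives
  stable equivalence.

  For the inequivalence, map \<open>M\<close> to affine maps over Laurent series in \<open>s = y\<^sup>-\<^sup>1\<close> with
  coefficients in \<open>\<int>[[u]]\<close>. AC-moves become left multiplications by matrices that are, up to powers
  of \<open>s\<close>, products of invertible matrices over power series in \<open>s\<close> and of \<open>diag(s, 1)\<close>. Such a
  product can be reduced (this is the geometry of the tree of \<open>SL\<^sub>2\<close>), and then its lowest
  coefficient is either invertible or of the form \<open>(v, w)\<^sup>T c (v', w')\<close> with unimodular
  \<open>(v, w)\<close> and \<open>(v', w')\<close>. The lowest coefficient \<open>(l - k) N\<close> of \<open>1 + (l - k) y N\<close> is not of this form,
  because the ideal \<open>(2, u)\<close> is proper although \<open>2\<close> and \<open>u\<close> have no common factor.\<close>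

unbundle no Formal_Power_Series.fps_syntax

section \<open>Products of dilations and invertible matrices over power series\<close>

abbreviation mat2 :: "'a \<Rightarrow> 'a \<Rightarrow> 'a \<Rightarrow> 'a \<Rightarrow> 'a::zero^2^2" where
  "mat2 a b c d \<equiv> vector [vector [a, b], vector [c, d]]"

lemma mat2_eq_iff:
  "A = B \<longleftrightarrow> A$1$1 = B$1$1 \<and> A$1$2 = B$1$2 \<and> A$2$1 = B$2$1 \<and> A$2$2 = (B$2$2 :: 'a)"
  for A B :: "'a^2^2"
  by (simp add: vec_eq_iff forall_2)

lemma mult_mat2_nth: "(A ** B) $ i $ j = A$i$1 * B$1$j + A$i$2 * B$2$j"
  for A B :: "'a::semiring_1^2^2"
  by (simp add: matrix_matrix_mult_def sum_2)

definition dilation :: "'a::idom fps^2^2" where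
  "dilation = mat2 fps_X 0 0 1"

lemma dilation_nth [simp]:
  "dilation$1$1 = fps_X" "dilation$1$2 = 0" "dilation$2$1 = 0" "dilation$2$2 = 1"
  by (simp_all add: dilation_def)

text \<open>With D for \<open>dilation\<close>, these are the words D k_1 D k_2 ... D k_m. The
  constant coefficient of D is diag(0, 1), so that of D k D has only the value of
  \<open>k$2$2\<close> at 0 in its lower right corner. Requiring this value to be nonzero, though
  not a unit, forbids backtracking in the tree.\<close>

inductive reduced_tail :: "'a::idom fps^2^2 \<Rightarrow> bool" where
  base: "det k dvd 1 \<Longrightarrow> reduced_tail (dilation ** k)"
| step: "det k dvd 1 \<Longrightarrow> reduced_tail h \<Longrightarrow> fps_nth (k$2$2) 0 \<noteq> 0 \<Longrightarrow> reduced_tail (dilation ** (k ** h))"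

definition reduced_matrix :: "'a::idom fps^2^2 \<Rightarrow> bool" where
  "reduced_matrix g \<longleftrightarrow> det g dvd 1 \<or> (\<exists>k h. det k dvd 1 \<and> reduced_tail h \<and> g = k ** h)"

definition unimodular :: "'a::comm_ring_1 \<Rightarrow> 'a \<Rightarrow> bool" where
  "unimodular a b \<longleftrightarrow> (\<exists>s t. s * a + t * b = 1)"

text \<open>The constant coefficient of \<open>det k\<close> is a unit; it is expanded along the
  second row and along the second column, the ones that survive next to
  \<open>dilation\<close>.\<close>

lemma unimodular_det:
  fixes k :: "'a::comm_ring_1 fps^2^2"
  assumes "det k dvd 1"
  shows "unimodular (fps_nth (k$2$1) 0) (fps_nth (k$2$2) 0)"
    "unimodular (fps_nth (k$1$2) 0) (fps_nth (k$2$2) 0)"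
proof -
  from assms obtain e where "1 = det k * e" by (auto simp: dvd_def)
  then have "fps_nth (1 :: 'a fps) 0 = fps_nth (det k * e) 0" by simp
  then have *: "(fps_nth (k$1$1) 0 * fps_nth (k$2$2) 0 - fps_nth (k$1$2) 0 * fps_nth (k$2$1) 0)
      * fps_nth e 0 = 1"
    by (simp add: det_2)
  have "(- fps_nth (k$1$2) 0 * fps_nth e 0) * fps_nth (k$2$1) 0
      + (fps_nth (k$1$1) 0 * fps_nth e 0) * fps_nth (k$2$2) 0 = 1"
    unfolding *[symmetric] by (simp add: algebra_simps)
  then show "unimodular (fps_nth (k$2$1) 0) (fps_nth (k$2$2) 0)"
    unfolding unimodular_def by blast
  have "(- fps_nth (k$2$1) 0 * fps_nth e 0) * fps_nth (k$1$2) 0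
      + (fps_nth (k$1$1) 0 * fps_nth e 0) * fps_nth (k$2$2) 0 = 1"
    unfolding *[symmetric] by (simp add: algebra_simps)
  then show "unimodular (fps_nth (k$1$2) 0) (fps_nth (k$2$2) 0)"
    unfolding unimodular_def by blast
qed

text \<open>At 0 the dilation is the projection diag(0, 1). It kills the first row, and each inner
  factor scales the second row by its nonzero corner value. So \<open>c\<close> is the product of
  these values and \<open>(v, w)\<close> comes from the last factor.\<close>

lemma reduced_tail_const:
  assumes "reduced_tail h"
  obtains c v w where "c \<noteq> 0" "unimodular v w"
    "fps_nth (h$1$1) 0 = 0" "fps_nth (h$1$2) 0 = 0" "fps_nth (h$2$1) 0 = c * v" "fps_nth (h$2$2) 0 = c * w"
proof -
  have "\<exists>c v w. c \<noteq> 0 \<and> unimodular v w \<and>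
    fps_nth (h$1$1) 0 = 0 \<and> fps_nth (h$1$2) 0 = 0 \<and> fps_nth (h$2$1) 0 = c * v \<and> fps_nth (h$2$2) 0 = c * w"
    using assms
  proof induction
    case (base k)
    then show ?case
      using unimodular_det(1)[of k]
      by (intro exI[of _ 1] exI[of _ "fps_nth (k$2$1) 0"] exI[of _ "fps_nth (k$2$2) 0"])
        (simp add: mult_mat2_nth)
  next
    case (step k h)
    then obtain c v w where "c \<noteq> 0" "unimodular v w"
      "fps_nth (h$1$1) 0 = 0" "fps_nth (h$1$2) 0 = 0" "fps_nth (h$2$1) 0 = c * v" "fps_nth (h$2$2) 0 = c * w"
      by blast
    with step.hyps show ?case
      by (intro exI[of _ "fps_nth (k$2$2) 0 * c"] exI[of _ v] exI[of _ w])
        (simp add: mult_mat2_nth mult.assoc)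
  qed
  then show ?thesis using that by blast
qed

text \<open>The constant coefficient of the tail has only a second row, so it meets only the second
  column of \<open>k\<close>, and the product is a column times a row.\<close>

lemma reduced_matrix_const:
  assumes "reduced_matrix g"
  shows "det g dvd 1 \<or> (\<exists>c v w v' w'. c \<noteq> 0 \<and> unimodular v w \<and> unimodular v' w' \<and>
    fps_nth (g$1$1) 0 = v * c * v' \<and> fps_nth (g$1$2) 0 = v * c * w' \<and>
    fps_nth (g$2$1) 0 = w * c * v' \<and> fps_nth (g$2$2) 0 = w * c * w')"
proof (cases "det g dvd 1")
  case False
  with assms obtain k h where kh: "det k dvd 1" "reduced_tail h" "g = k ** h"
    by (auto simp: reduced_matrix_def)
  from kh(2) obtain c v w where "c \<noteq> 0" "unimodular v w"
    "fps_nth (h$1$1) 0 = 0" "fps_nth (h$1$2) 0 = 0" "fps_nth (h$2$1) 0 = c * v" "fps_nth (h$2$2) 0 = c * w"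
    by (rule reduced_tail_const)
  with kh unimodular_det(2)[of k] show ?thesis
    by (intro disjI2 exI[of _ c] exI[of _ "fps_nth (k$1$2) 0"] exI[of _ "fps_nth (k$2$2) 0"]
        exI[of _ v] exI[of _ w])
      (simp add: mult_mat2_nth)
qed simp

lemma reduced_matrix_mult:
  assumes "det k dvd 1" "reduced_matrix g"
  shows "reduced_matrix (k ** g)"
proof -
  have *: "det (k ** l) dvd 1" if "det l dvd 1" for l
    using mult_dvd_mono[OF assms(1) that] by (simp add: det_mul)
  from assms(2) consider "det g dvd 1"
    | l h where "det l dvd 1" "reduced_tail h" "g = l ** h"
    unfolding reduced_matrix_def by blast
  then show ?thesis
  proof cases
    case 1
    then show ?thesis
      unfolding reduced_matrix_def using * by blast
  next
    case (2 l h)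
    then have "k ** g = (k ** l) ** h"
      by (simp add: matrix_mul_assoc)
    then show ?thesis
      unfolding reduced_matrix_def using 2 * by blast
  qed
qed

lemma reduced_matrix_tail:
  assumes "reduced_tail h"
  shows "reduced_matrix h"
  unfolding reduced_matrix_def
proof (intro disjI2 exI conjI)
  show "h = mat 1 ** h" by simp
qed (use assms in simp_all)

text \<open>If the lower right entry of \<open>k\<close> vanishes at \<open>0\<close>, then \<open>dilation ** k ** dilation\<close> is
  \<open>fps_X\<close> times an invertible matrix, which makes the word shorter.\<close>

lemma reduced_matrix_dilation:
  assumes "reduced_matrix g"
  shows "reduced_matrix (dilation ** g) \<or>
    (\<exists>g'. reduced_matrix g' \<and> dilation ** g = (\<chi> i j. fps_X * g'$i$j))"
proof (cases "det g dvd 1")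
  case True
  then have "reduced_tail (dilation ** g)" by (rule reduced_tail.base)
  then show ?thesis
    by (simp add: reduced_matrix_tail)
next
  case False
  with assms obtain k h where kh: "det k dvd 1" "reduced_tail h" "g = k ** h"
    by (auto simp: reduced_matrix_def)
  show ?thesis
  proof (cases "fps_nth (k$2$2) 0 = 0")
    case nz: False
    then have "reduced_tail (dilation ** g)"
      using kh by (auto intro: reduced_tail.step)
    then show ?thesis
      by (simp add: reduced_matrix_tail)
  next
    case True
    obtain h' where h: "h = dilation ** h'" and h': "reduced_matrix h'"
      using kh(2) by cases (auto simp: reduced_matrix_def)
    define d where "d = fps_shift 1 (k$2$2)"
    have d: "k$2$2 = fps_X * d"
    proof (rule fps_ext)
      show "fps_nth (k$2$2) n = fps_nth (fps_X * d) n" for n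
        using True by (cases n) (simp_all add: d_def)
    qed
    \<comment> \<open>This is \<open>dilation ** k ** dilation\<close> divided by
      \<open>fps_X\<close>. Compared with \<open>k\<close>, a factor \<open>fps_X\<close> has moved
      from the lower right to the upper left entry, so the determinant is unchanged.\<close>
    define k' where "k' = mat2 (fps_X * k$1$1) (k$1$2) (k$2$1) d"
    have "det k' = det k"
      by (simp add: k'_def det_2 d mult.assoc mult.left_commute)
    then have "reduced_matrix (k' ** h')"
      using kh(1) h' by (simp add: reduced_matrix_mult)
    moreover have "dilation ** g = (\<chi> i j. fps_X * (k' ** h')$i$j)"
      unfolding kh(3) h by (simp add: mat2_eq_iff mult_mat2_nth k'_def d algebra_simps)
    ultimately show ?thesis by (intro disjI2 exI[of _ "k' ** h'"] conjI)
  qed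
qed

text \<open>A constant of its own, because the simplifier merges the shift behind the abbreviation
  \<open>fls_X_intpow\<close> with its surroundings.\<close>

definition X_intpow :: "int \<Rightarrow> 'a::comm_ring_1 fls" where
  "X_intpow i = fls_X_intpow i"

lemma X_intpow_add: "X_intpow (i + j) = X_intpow i * X_intpow j"
  by (simp add: X_intpow_def fls_X_intpow_times_fls_X_intpow)

lemma X_intpow_0 [simp]: "X_intpow 0 = 1"
  by (simp add: X_intpow_def)

lemma X_intpow_1: "X_intpow 1 = fls_X"
  by (simp only: X_intpow_def fls_X_conv_shift_1)

lemma X_intpow_minus_1 [simp]:
  "X_intpow (-1) * fls_X = (1 :: 'a::comm_ring_1 fls)" "X_intpow (-1) * (fls_X * f) = (f :: 'a fls)"
proof -
  show *: "X_intpow (-1) * fls_X = (1 :: 'a fls)"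
    using X_intpow_add[of "-1" 1, where 'a = 'a] by (simp add: X_intpow_1)
  show "X_intpow (-1) * (fls_X * f) = f"
    by (simp only: mult.assoc[symmetric] * mult_1_left)
qed

lemma X_intpow_mult_nth: "fls_nth (X_intpow i * f) n = fls_nth f (n - i)"
  unfolding X_intpow_def fls_X_intpow_times_conv_shift(1) by simp

lemma X_intpow_nth [simp]: "fls_nth (X_intpow i) n = (if n = i then 1 else 0)"
  using X_intpow_mult_nth[of i 1 n] by simp

section \<open>Laurent matrices that are reduced words up to a power of s\<close>

definition laurent_scale :: "int \<Rightarrow> 'a::idom fps^2^2 \<Rightarrow> 'a fls^2^2" where
  "laurent_scale j g = (\<chi> a b. X_intpow j * fps_to_fls (g$a$b))"

lemma laurent_scale_nth [simp]: "laurent_scale j g $ a $ b = X_intpow j * fps_to_fls (g$a$b)"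
  by (simp add: laurent_scale_def)

lemma laurent_scale_mult: "laurent_scale i k ** laurent_scale j g = laurent_scale (i + j) (k ** g)"
proof -
  have "a * u * (b * v) + a * u' * (b * v') = a * b * (u * v + u' * v')" for a b u v u' v' :: "'a fls"
    by (simp add: algebra_simps)
  then show ?thesis
    by (simp add: mat2_eq_iff mult_mat2_nth fls_times_fps_to_fls X_intpow_add)
qed

text \<open>A normal form instead of a monoid given by generators: it lets the lowest coefficient be
  read off from \<open>g\<close>. Closure under the generators is proved below.\<close>

definition dilation_word :: "'a::idom fls^2^2 \<Rightarrow> bool" where
  "dilation_word h \<longleftrightarrow> (\<exists>j g. reduced_matrix g \<and> h = laurent_scale j g)"

lemma dilation_word_scale:
  assumes "det k dvd 1" "dilation_word h"
  shows "dilation_word (laurent_scale i k ** h)"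
proof -
  from assms(2) obtain j g where "reduced_matrix g" "h = laurent_scale j g"
    by (auto simp: dilation_word_def)
  with reduced_matrix_mult[OF assms(1)] show ?thesis
    by (auto simp: dilation_word_def laurent_scale_mult)
qed

lemma dilation_word_dilation:
  assumes "dilation_word h"
  shows "dilation_word (laurent_scale i dilation ** h)"
proof -
  from assms obtain j g where g: "reduced_matrix g" "h = laurent_scale j g"
    by (auto simp: dilation_word_def)
  from reduced_matrix_dilation[OF g(1)] show ?thesis
  proof (elim disjE exE conjE)
    assume "reduced_matrix (dilation ** g)"
    then show ?thesis
      unfolding dilation_word_def g(2) laurent_scale_mult by blast
  next
    fix g'
    assume g': "reduced_matrix g'" "dilation ** g = (\<chi> i j. fps_X * g'$i$j)"
    have "laurent_scale i dilation ** h = laurent_scale (i + j + 1) g'"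
      unfolding g(2) laurent_scale_mult g'(2)
      by (simp add: mat2_eq_iff X_intpow_add X_intpow_1 fls_times_fps_to_fls mult.assoc)
    with g'(1) show ?thesis
      unfolding dilation_word_def by blast
  qed
qed

lemma det_swap_dvd_1: "det (mat2 0 1 1 0 :: 'a::comm_ring_1^2^2) dvd 1"
  by (simp add: det_2)

text \<open>Factors diag(s, 1) are multiplied in one at a time. For negative powers, diag(s^-1, 1)
  is s^-1 times the dilation conjugated by the coordinate swap. The unit \<open>e\<close> goes into
  an invertible matrix over power series.\<close>

lemma dilation_word_diag1:
  assumes "dilation_word h" "e dvd 1"
  shows "dilation_word (mat2 (X_intpow i * fps_to_fls e) 0 0 1 ** h)"
proof -
  have *: "dilation_word (mat2 (X_intpow i) 0 0 1 ** h)" for i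
  proof (induction i rule: int_induct[of _ 0])
    case base
    have "mat2 (X_intpow 0) 0 0 1 ** h = h"
      by (simp add: mat2_eq_iff mult_mat2_nth)
    with assms(1) show ?case by simp
  next
    case (step1 i)
    have "mat2 (X_intpow (i + 1)) 0 0 1 ** h
      = laurent_scale 0 dilation ** (mat2 (X_intpow i) 0 0 1 ** h)"
      by (simp add: mat2_eq_iff mult_mat2_nth X_intpow_add X_intpow_1 mult.assoc mult.left_commute)
    with dilation_word_dilation[OF step1(2)] show ?case by simp
  next
    case (step2 i)
    have "mat2 (X_intpow (i - 1)) 0 0 1 ** h = laurent_scale 0 (mat2 0 1 1 0) **
        (laurent_scale (-1) dilation ** (laurent_scale 0 (mat2 0 1 1 0) **
          (mat2 (X_intpow i) 0 0 1 ** h)))"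
      using X_intpow_add[of i "-1", where 'a = 'a]
      by (simp add: mat2_eq_iff mult_mat2_nth mult.assoc mult.left_commute)
    then show ?case
      using step2(2)
      by (simp add: dilation_word_scale dilation_word_dilation det_swap_dvd_1)
  qed
  have "mat2 (X_intpow i * fps_to_fls e) 0 0 1 ** h
      = laurent_scale 0 (mat2 e 0 0 1) ** (mat2 (X_intpow i) 0 0 1 ** h)"
    by (simp add: mat2_eq_iff mult_mat2_nth mult.assoc mult.left_commute)
  then show ?thesis
    using dilation_word_scale[OF _ *] assms(2) by (simp add: det_2)
qed

lemma dilation_word_diag2:
  assumes "dilation_word h" "e dvd 1"
  shows "dilation_word (mat2 1 0 0 (X_intpow i * fps_to_fls e) ** h)"
proof -
  have "mat2 1 0 0 (X_intpow i * fps_to_fls e) ** h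
      = laurent_scale 0 (mat2 0 1 1 0) ** (mat2 (X_intpow i * fps_to_fls e) 0 0 1 **
        (laurent_scale 0 (mat2 0 1 1 0) ** h))"
    by (simp add: mat2_eq_iff mult_mat2_nth)
  then show ?thesis
    using assms by (simp add: dilation_word_scale dilation_word_diag1 det_swap_dvd_1)
qed

section \<open>The lowest coefficient as an obstruction\<close>

lemma reduced_matrix_const_nonzero:
  assumes "reduced_matrix g"
  obtains a b where "fps_nth (g$a$b) 0 \<noteq> 0"
proof (rule ccontr)
  assume "\<not> thesis"
  with that have zero: "fps_nth (g$a$b) 0 = 0" for a b by blast
  from reduced_matrix_const[OF assms] show False
  proof (elim disjE exE conjE)
    assume "det g dvd 1"
    from unimodular_det(1)[OF this] show False
      by (simp add: zero unimodular_def)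
  next
    fix c v w v' w'
    assume c: "c \<noteq> 0" and u: "unimodular v w" "unimodular v' w'"
      and "fps_nth (g$1$1) 0 = v * c * v'" "fps_nth (g$1$2) 0 = v * c * w'"
        "fps_nth (g$2$1) 0 = w * c * v'" "fps_nth (g$2$2) 0 = w * c * w'"
    with zero have "v * v' = 0" "v * w' = 0" "w * v' = 0" "w * w' = 0" by auto
    with u show False by (auto simp: unimodular_def)
  qed
qed

text \<open>The exponent \<open>j\<close> must be -1, because neither N nor the constant coefficient
  of \<open>g\<close> vanishes. Hence that coefficient is N, and \<open>det N = 0\<close> leaves
  only the second alternative of \<open>reduced_matrix_const\<close>.\<close>

lemma dilation_word_rank1:
  fixes N :: "'a::idom^2^2"
  assumes "dilation_word (\<chi> a b. (if a = b then 1 else 0) + X_intpow (-1) * fls_const (N$a$b))"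
    and "N \<noteq> 0" "det N = 0"
  obtains c v w v' w' where "unimodular v w" "unimodular v' w'"
    "N$1$1 = v * c * v'" "N$1$2 = v * c * w'" "N$2$1 = w * c * v'" "N$2$2 = w * c * w'"
proof -
  from assms(1) obtain j g where g: "reduced_matrix g"
    "(\<chi> a b. (if a = b then 1 else 0) + X_intpow (-1) * fls_const (N$a$b)) = laurent_scale j g"
    by (auto simp: dilation_word_def)
  have nth: "(if n < j then 0 else fps_nth (g$a$b) (nat (n - j)))
      = (if a = b \<and> n = 0 then 1 else 0) + (if n = -1 then N$a$b else 0)" for a b n
  proof -
    have "fls_nth (laurent_scale j g $ a $ b) n
      = fls_nth ((if a = b then 1 else 0) + X_intpow (-1) * fls_const (N$a$b)) n"
      unfolding g(2)[symmetric] by simp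
    then show ?thesis
      by (auto simp: X_intpow_mult_nth)
  qed
  obtain a b where "N$a$b \<noteq> 0"
    using assms(2) by (auto simp: vec_eq_iff)
  then have "j \<le> -1"
    using nth[of "-1" a b] by (auto split: if_splits)
  moreover from reduced_matrix_const_nonzero[OF g(1)] obtain a b where "fps_nth (g$a$b) 0 \<noteq> 0" .
  then have "j \<ge> -1"
    using nth[of j a b] by (auto split: if_splits)
  ultimately have j: "j = -1" by simp
  have N: "fps_nth (g$a$b) 0 = N$a$b" for a b
    using nth[of "-1" a b] by (simp add: j)
  from reduced_matrix_const[OF g(1)] show thesis
  proof
    assume "det g dvd 1"
    then obtain e where "1 = det g * e" by (auto simp: dvd_def)
    then have "fps_nth 1 0 = fps_nth (det g * e) 0" by simp
    also have "\<dots> = det N * fps_nth e 0"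
      by (simp add: det_2 N)
    finally show thesis using assms(3) by simp
  qed (elim exE conjE, rule that, simp_all only: N)
qed

text \<open>Here \<open>fps_X\<close> is the variable u of the coefficient ring, and N is m times
  the column (2, -u) times the row (u, 2). In a factorization with unimodular vectors, c is a
  combination of the entries of N, so d = c / m has even constant coefficient. But d divides 4,
  which makes this coefficient nonzero, and then, as d divides u^2, it must be 1 or -1.\<close>

lemma not_dilation_word:
  fixes m :: int
  assumes "m \<noteq> 0"
  defines "N \<equiv> mat2 (2 * of_int m * fps_X) (4 * of_int m)
     (- (of_int m * fps_X ^ 2)) (- (2 * of_int m * fps_X)) :: int fps^2^2"
  shows "\<not> dilation_word (\<chi> a b. (if a = b then 1 else 0) + X_intpow (-1) * fls_const (N$a$b))"
proof
  have m: "(of_int m :: int fps) \<noteq> 0"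
    using assms(1) by (auto dest: arg_cong[of _ _ "\<lambda>f. fps_nth f 0"])
  assume "dilation_word (\<chi> a b. (if a = b then 1 else 0) + X_intpow (-1) * fls_const (N$a$b))"
  moreover have "N \<noteq> 0"
    using m by (auto simp: mat2_eq_iff N_def)
  moreover have "det N = 0"
    by (simp add: N_def det_2 power2_eq_square)
  ultimately obtain c v w v' w' where u: "unimodular v w" "unimodular v' w'" and
    N: "N$1$1 = v * c * v'" "N$1$2 = v * c * w'" "N$2$1 = w * c * v'" "N$2$2 = w * c * w'"
    by (rule dilation_word_rank1)
  from u obtain s t s' t' where st: "s * v + t * w = 1" "s' * v' + t' * w' = 1"
    by (auto simp: unimodular_def)
  have "c = (s * v + t * w) * c * (s' * v' + t' * w')"
    by (simp add: st)
  also have "\<dots> = s * s' * (v * c * v') + s * t' * (v * c * w')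
      + t * s' * (w * c * v') + t * t' * (w * c * w')"
    by (simp add: algebra_simps)
  also have "\<dots> = of_int m * (2 * (s * s' * fps_X + 2 * s * t' - t * t' * fps_X) - t * s' * fps_X ^ 2)"
    unfolding N[symmetric] by (simp add: N_def algebra_simps)
  finally obtain d where c: "c = of_int m * d"
    and d: "d = 2 * (s * s' * fps_X + 2 * s * t' - t * t' * fps_X) - t * s' * fps_X ^ 2"
    by blast
  have d0: "even (fps_nth d 0)"
    by (simp add: d power2_eq_square)
  have "of_int m * (v * d * w') = of_int m * 4" "of_int m * (w * d * v') = of_int m * - (fps_X ^ 2)"
    using N(2,3) by (simp_all add: N_def c algebra_simps)
  then have four: "v * d * w' = 4" and X2: "d * (w * v') = - (fps_X ^ 2)"
    using m unfolding mult_cancel_left by (simp_all add: ac_simps)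
  have "fps_nth (v * d * w') 0 = fps_nth 4 0"
    by (simp only: four)
  then have "fps_nth d 0 \<noteq> 0"
    by (auto simp: numeral_fps_const)
  \<comment> \<open>Since d does not vanish at 0, the equations in degrees 0 and 1 kill the
    coefficients of \<open>w * v'\<close> there, and degree 2 yields the contradiction.\<close>
  moreover have "fps_nth (d * (w * v')) n = fps_nth (- (fps_X ^ 2)) n" for n
    by (simp only: X2)
  from this[of 0] this[of 1] this[of 2]
  have "fps_nth d 0 * fps_nth (w * v') 0 = 0"
    "fps_nth d 0 * fps_nth (w * v') 1 + fps_nth d 1 * fps_nth (w * v') 0 = 0"
    "fps_nth d 0 * fps_nth (w * v') 2 + (fps_nth d 1 * fps_nth (w * v') 1
      + fps_nth d 2 * fps_nth (w * v') 0) = - 1"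
    by (simp_all only: fps_mult_nth[of d "w * v'"])
      (simp_all add: numeral_2_eq_2 del: fps_mult_nth_0 fps_mult_nth_1)
  ultimately have "fps_nth d 0 * fps_nth (w * v') 2 = - 1"
    by auto
  with d0 show False
    by (metis even_minus even_mult_iff odd_one)
qed

section \<open>Normal closures and AC-moves\<close>

context group
begin

lemma normal_closure_incl: "A \<subseteq> normal_closure G A"
  by (auto simp: normal_closure_def)

lemma normal_closure_minimal: "N \<lhd> G \<Longrightarrow> A \<subseteq> N \<Longrightarrow> normal_closure G A \<subseteq> N"
  by (auto simp: normal_closure_def)

lemma normal_carrier: "carrier G \<lhd> G"
  by (simp add: normal_inv_iff subgroup_self)

lemma normal_normal_closure:
  assumes "A \<subseteq> carrier G"
  shows "normal_closure G A \<lhd> G"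
proof -
  have "subgroup (normal_closure G A) G"
    unfolding normal_closure_def
    by (rule subgroups_Inter) (use assms normal_carrier normal_imp_subgroup in auto)
  then show ?thesis
    by (auto simp: normal_inv_iff normal_closure_def)
qed

end

lemma AC_move_append:
  assumes "i < length y" "j < length y" "j \<noteq> i"
  shows "AC_equivalent G y (y[i := y ! i \<otimes>\<^bsub>G\<^esub> y ! j])"
  using AC_move.AC1[OF assms] by (auto simp: AC_equivalent_def)

lemma AC_equivalent_refl: "AC_equivalent G y y"
  by (simp add: AC_equivalent_def)

lemma AC_equivalent_trans [trans]:
  "AC_equivalent G x y \<Longrightarrow> AC_equivalent G y z \<Longrightarrow> AC_equivalent G x z"
  by (simp add: AC_equivalent_def)

context group
begin

lemma inv_mult_cancel [simp]:
  assumes "x \<in> carrier G" "y \<in> carrier G"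
  shows "inv x \<otimes> (x \<otimes> y) = y" "x \<otimes> (inv x \<otimes> y) = y"
  using assms by (simp_all flip: m_assoc)

lemma AC_mult:
  assumes "i < length y" "j < length y" "j \<noteq> i"
  shows "AC_equivalent G (y[i := a]) (y[i := a \<otimes> y ! j])"
  using AC_move_append[of i "y[i := a]" j G] assms by simp

lemma AC_inv:
  assumes "i < length y"
  shows "AC_equivalent G (y[i := a]) (y[i := inv a])"
  using AC_move.AC2[of i "y[i := a]" G] assms by (auto simp: AC_equivalent_def)

lemma AC_conj:
  assumes "i < length y" "g \<in> carrier G"
  shows "AC_equivalent G (y[i := a]) (y[i := g \<otimes> a \<otimes> inv g])"
  using AC_move.AC3[of i "y[i := a]" g G] assms by (auto simp: AC_equivalent_def)

text \<open>The elements that can be multiplied onto entry i, whatever this entry is, form a normal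
  subgroup N containing the other entries. The quantifier over \<open>a\<close> in N allows such
  moves to be composed.\<close>

lemma AC_mult_normal_closure:
  assumes i: "i < length y" and y: "set y \<subseteq> carrier G" and "a \<in> carrier G"
    and "h \<in> normal_closure G {y ! j | j. j < length y \<and> j \<noteq> i}" (is "_ \<in> normal_closure G ?A")
  shows "AC_equivalent G (y[i := a]) (y[i := a \<otimes> h])"
proof -
  define N where "N = {h \<in> carrier G. \<forall>a\<in>carrier G. AC_equivalent G (y[i := a]) (y[i := a \<otimes> h])}"
  have conj: "g \<otimes> h \<otimes> inv g \<in> N" if g: "g \<in> carrier G" and h: "h \<in> N" for g h
    unfolding N_def
  proof (intro CollectI conjI ballI)
    fix a assume a: "a \<in> carrier G"
    \<comment> \<open>Conjugate the entry by the inverse of g, multiply by h, and conjugate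
      back.\<close>
    have "AC_equivalent G (y[i := a]) (y[i := inv g \<otimes> a \<otimes> inv (inv g)])"
      using AC_conj[OF i, of "inv g"] g by simp
    also have "AC_equivalent G \<dots> (y[i := inv g \<otimes> a \<otimes> inv (inv g) \<otimes> h])"
      using h g a by (simp add: N_def)
    also have "AC_equivalent G \<dots> (y[i := g \<otimes> (inv g \<otimes> a \<otimes> inv (inv g) \<otimes> h) \<otimes> inv g])"
      using AC_conj[OF i g] .
    also have "g \<otimes> (inv g \<otimes> a \<otimes> inv (inv g) \<otimes> h) \<otimes> inv g = a \<otimes> (g \<otimes> h \<otimes> inv g)"
      using g h a by (simp add: N_def m_assoc)
    finally show "AC_equivalent G (y[i := a]) (y[i := a \<otimes> (g \<otimes> h \<otimes> inv g)])" .
  qed (use g h in \<open>simp add: N_def\<close>)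
  have "subgroup N G"
  proof (rule subgroupI)
    show "N \<subseteq> carrier G" by (auto simp: N_def)
    show "N \<noteq> {}"
      by (auto simp: N_def AC_equivalent_refl intro!: exI[of _ \<one>])
  next
    fix h assume h: "h \<in> N"
    show "inv h \<in> N"
      unfolding N_def
    proof (intro CollectI conjI ballI)
      fix a assume a: "a \<in> carrier G"
      \<comment> \<open>Multiplying a^-1 by the conjugate a h a^-1 gives h a^-1, whose inverse is a
        h^-1.\<close>
      have "AC_equivalent G (y[i := a]) (y[i := inv a])"
        by (rule AC_inv[OF i])
      also have "AC_equivalent G \<dots> (y[i := inv a \<otimes> (a \<otimes> h \<otimes> inv a)])"
        using conj[OF a h] a by (simp add: N_def)
      also have "AC_equivalent G \<dots> (y[i := inv (inv a \<otimes> (a \<otimes> h \<otimes> inv a))])"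
        by (rule AC_inv[OF i])
      also have "inv (inv a \<otimes> (a \<otimes> h \<otimes> inv a)) = a \<otimes> inv h"
        using a h by (simp add: N_def inv_mult_group m_assoc)
      finally show "AC_equivalent G (y[i := a]) (y[i := a \<otimes> inv h])" .
    qed (use h in \<open>simp add: N_def\<close>)
  next
    fix h k assume hk: "h \<in> N" "k \<in> N"
    then show "h \<otimes> k \<in> N"
      unfolding N_def by (auto intro: AC_equivalent_trans simp flip: m_assoc)
  qed
  with conj have "N \<lhd> G"
    by (simp add: normal_inv_iff)
  moreover have "?A \<subseteq> N"
    using i y by (auto simp: N_def intro!: AC_mult)
  ultimately show ?thesis
    using assms(3,4) normal_closure_minimal[of N ?A] by (auto simp: N_def)
qed

text \<open>Sets are compared through arbitrary listings, so pairs must be reversible by moves.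
  Conjugations correct the order of the factors.\<close>

lemma AC_swap:
  assumes a: "a \<in> carrier G" and b: "b \<in> carrier G"
  shows "AC_equivalent G [a, b] [b, a]"
proof -
  have 1: "AC_equivalent G [u, v] [u \<otimes> v, v]" "AC_equivalent G [u, v] [u, v \<otimes> u]"
    "AC_equivalent G [u, v] [u, inv v]" for u v
    using AC_mult[of 0 "[u, v]" 1 u] AC_mult[of 1 "[u, v]" 0 v] AC_inv[of 1 "[u, v]" v] by auto
  have 2: "AC_equivalent G [u, v] [g \<otimes> u \<otimes> inv g, v]" "AC_equivalent G [u, v] [u, g \<otimes> v \<otimes> inv g]"
    if "g \<in> carrier G" for g u v
    using AC_conj[of 0 "[u, v]" g u] AC_conj[of 1 "[u, v]" g v] that by auto
  have "AC_equivalent G [a, b] [a \<otimes> b, b]" by (rule 1)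
  also have "AC_equivalent G \<dots> [a \<otimes> b, inv b]" by (rule 1)
  also have "AC_equivalent G \<dots> [a \<otimes> b, inv b \<otimes> (a \<otimes> b)]" by (rule 1)
  also have "AC_equivalent G \<dots> [a \<otimes> b, b \<otimes> (inv b \<otimes> (a \<otimes> b)) \<otimes> inv b]" by (rule 2) (rule b)
  also have "b \<otimes> (inv b \<otimes> (a \<otimes> b)) \<otimes> inv b = a"
    using a b by (simp add: m_assoc)
  also have "AC_equivalent G [a \<otimes> b, a] [a \<otimes> b, inv a]" by (rule 1)
  also have "AC_equivalent G \<dots> [a \<otimes> b \<otimes> inv a, inv a]" by (rule 1)
  also have "AC_equivalent G \<dots> [inv a \<otimes> (a \<otimes> b \<otimes> inv a) \<otimes> inv (inv a), inv a]"
    by (rule 2) (simp add: a)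
  also have "inv a \<otimes> (a \<otimes> b \<otimes> inv a) \<otimes> inv (inv a) = b"
    using a b by (simp add: m_assoc)
  also have "AC_equivalent G [b, inv a] [b, inv (inv a)]" by (rule 1)
  finally show ?thesis using a by simp
qed

end

section \<open>A transvection of pairs in an abelian normal subgroup\<close>

text \<open>In module notation the two shifts add \<open>e\<close> times the column (2, 1 - x) to
  (a, b), and \<open>twist\<close> applies the row y (x - 1, 2). They are products in an arbitrary
  group because they are also evaluated on words in F.\<close>

definition shift_fst :: "('a, 'b) monoid_scheme \<Rightarrow> 'a \<Rightarrow> 'a \<Rightarrow> 'a" where
  "shift_fst G a e = a \<otimes>\<^bsub>G\<^esub> (e \<otimes>\<^bsub>G\<^esub> e)"

definition shift_snd :: "('a, 'b) monoid_scheme \<Rightarrow> 'a \<Rightarrow> 'a \<Rightarrow> 'a \<Rightarrow> 'a" where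
  "shift_snd G x b e = b \<otimes>\<^bsub>G\<^esub> (e \<otimes>\<^bsub>G\<^esub> (x \<otimes>\<^bsub>G\<^esub> inv\<^bsub>G\<^esub> e \<otimes>\<^bsub>G\<^esub> inv\<^bsub>G\<^esub> x))"

definition twist :: "('a, 'b) monoid_scheme \<Rightarrow> 'a \<Rightarrow> 'a \<Rightarrow> 'a \<Rightarrow> 'a \<Rightarrow> 'a" where
  "twist G x y a b =
     y \<otimes>\<^bsub>G\<^esub> (x \<otimes>\<^bsub>G\<^esub> a \<otimes>\<^bsub>G\<^esub> inv\<^bsub>G\<^esub> x \<otimes>\<^bsub>G\<^esub> inv\<^bsub>G\<^esub> a \<otimes>\<^bsub>G\<^esub> (b \<otimes>\<^bsub>G\<^esub> b)) \<otimes>\<^bsub>G\<^esub> inv\<^bsub>G\<^esub> y"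

text \<open>In module notation, with \<open>w = y (x - 1) a + 2 y b\<close>, the pair \<open>(a, b)\<close> is mapped to
  \<open>(a + 2 k w, b + k (1 - x) w)\<close>. As \<open>w\<close> is the same for the new pair, these maps compose like
  the integers \<open>k\<close>.\<close>

definition step_fst :: "('a, 'b) monoid_scheme \<Rightarrow> 'a \<Rightarrow> 'a \<Rightarrow> int \<Rightarrow> 'a \<Rightarrow> 'a \<Rightarrow> 'a" where
  "step_fst G x y k a b = shift_fst G a (twist G x y a b [^]\<^bsub>G\<^esub> k)"

definition step_snd :: "('a, 'b) monoid_scheme \<Rightarrow> 'a \<Rightarrow> 'a \<Rightarrow> int \<Rightarrow> 'a \<Rightarrow> 'a \<Rightarrow> 'a" where
  "step_snd G x y k a b = shift_snd G x b (twist G x y a b [^]\<^bsub>G\<^esub> k)"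

text \<open>The row (x - 1, 2) annihilates the column (2, 1 - x). In \<open>twist_shift\<close>,
  \<open>a\<close> becomes the conjugate of the first entry by x, \<open>a'\<close> the inverse of
  that entry, and \<open>f\<close> the conjugate of \<open>e\<close>.\<close>

lemma (in comm_group) shift_twist_cancel:
  assumes "a \<in> carrier G" "a' \<in> carrier G" "b \<in> carrier G" "e \<in> carrier G" "e' \<in> carrier G"
    "f \<in> carrier G" "f' \<in> carrier G" "e \<otimes> e' = \<one>" "f \<otimes> f' = \<one>"
  shows "a \<otimes> (f \<otimes> f) \<otimes> (a' \<otimes> (e' \<otimes> e')) \<otimes> (b \<otimes> (e \<otimes> f') \<otimes> (b \<otimes> (e \<otimes> f'))) = a \<otimes> a' \<otimes> (b \<otimes> b)"
proof -
  have "e \<otimes> (e' \<otimes> z) = z" "f \<otimes> (f' \<otimes> z) = z" if "z \<in> carrier G" for z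
    using assms that by (simp_all flip: m_assoc)
  with assms show ?thesis by (simp add: m_ac)
qed

lemma (in group) conj_hom:
  assumes "x \<in> carrier G" "a \<in> carrier G" "b \<in> carrier G"
  shows "x \<otimes> (a \<otimes> b) \<otimes> inv x = (x \<otimes> a \<otimes> inv x) \<otimes> (x \<otimes> b \<otimes> inv x)"
  using assms by (simp add: m_assoc)

lemma (in group) conj_inv:
  assumes "x \<in> carrier G" "a \<in> carrier G"
  shows "inv (x \<otimes> a \<otimes> inv x) = x \<otimes> inv a \<otimes> inv x"
  using assms by (simp add: m_assoc inv_mult_group)

lemma (in group) step_closed:
  assumes "x \<in> carrier G" "y \<in> carrier G" "a \<in> carrier G" "b \<in> carrier G"
  shows "twist G x y a b \<in> carrier G" "step_fst G x y k a b \<in> carrier G"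
    "step_snd G x y k a b \<in> carrier G"
  using assms by (simp_all add: twist_def step_fst_def step_snd_def shift_fst_def shift_snd_def)

lemma (in normal) step_in_normal:
  assumes "x \<in> carrier G" "y \<in> carrier G" "a \<in> H" "b \<in> H"
  shows "twist G x y a b [^] (k::int) \<in> H" "step_fst G x y k a b \<in> H" "step_snd G x y k a b \<in> H"
proof -
  have shift: "shift_fst G a e \<in> H" "shift_snd G x b e \<in> H" if "e \<in> H" for e
    using assms that by (simp_all add: shift_fst_def shift_snd_def inv_op_closed2)
  have "twist G x y a b \<in> H"
    using assms by (simp add: twist_def inv_op_closed2)
  then show *: "twist G x y a b [^] (k::int) \<in> H"
    by (rule subgroup_int_pow_closed[OF subgroup_axioms])
  show "step_fst G x y k a b \<in> H" "step_snd G x y k a b \<in> H"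
    unfolding step_fst_def step_snd_def using shift[OF *] by auto
qed

locale abelian_normal = normal A G for A and G (structure) +
  fixes x y
  assumes A_comm: "a \<in> A \<Longrightarrow> b \<in> A \<Longrightarrow> a \<otimes> b = b \<otimes> a"
    and x [simp]: "x \<in> carrier G" and y [simp]: "y \<in> carrier G"
begin

sublocale A: comm_group "G\<lparr>carrier := A\<rparr>"
  rewrites "carrier (G\<lparr>carrier := A\<rparr>) = A" and "monoid.mult (G\<lparr>carrier := A\<rparr>) = monoid.mult G"
    and "one (G\<lparr>carrier := A\<rparr>) = one G"
proof -
  show "comm_group (G\<lparr>carrier := A\<rparr>)"
    by (rule group.group_comm_groupI[OF subgroup_imp_group[OF subgroup_axioms]]) (simp add: A_comm)
qed simp_all

lemma conj_closed [simp]: "g \<in> carrier G \<Longrightarrow> a \<in> A \<Longrightarrow> g \<otimes> a \<otimes> inv g \<in> A"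
  by (rule inv_op_closed2)

lemma shift_closed:
  assumes "a \<in> A" "b \<in> A" "e \<in> A"
  shows "shift_fst G a e \<in> A" "shift_snd G x b e \<in> A"
  using assms by (simp_all add: shift_fst_def shift_snd_def)

lemma twist_shift:
  assumes a: "a \<in> A" and b: "b \<in> A" and e: "e \<in> A"
  shows "twist G x y (shift_fst G a e) (shift_snd G x b e) = twist G x y a b"
proof -
  define a' e' f f' where "a' = inv a" and "e' = inv e"
    and "f = x \<otimes> e \<otimes> inv x" and "f' = x \<otimes> inv e \<otimes> inv x"
  have A: "a' \<in> A" "e' \<in> A" "f \<in> A" "f' \<in> A" "e \<otimes> e' = \<one>" "f \<otimes> f' = \<one>"
    using a e by (simp_all add: a'_def e'_def f_def f'_def flip: conj_inv)
  have 1: "x \<otimes> (a \<otimes> (e \<otimes> e)) \<otimes> inv x = x \<otimes> a \<otimes> inv x \<otimes> (f \<otimes> f)"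
    using a e by (simp add: f_def conj_hom)
  have 2: "inv (a \<otimes> (e \<otimes> e)) = a' \<otimes> (e' \<otimes> e')"
    using a e by (simp add: a'_def e'_def inv_mult_group A.m_ac)
  show ?thesis
    unfolding twist_def shift_fst_def shift_snd_def 1 2 f'_def[symmetric]
    using A.shift_twist_cancel[of "x \<otimes> a \<otimes> inv x" a' b e e' f f'] a b e A
    by (simp flip: a'_def)
qed

lemma shift_shift:
  assumes a: "a \<in> A" and b: "b \<in> A" and e: "e \<in> A" "e' \<in> A"
  shows "shift_fst G (shift_fst G a e) e' = shift_fst G a (e \<otimes> e')"
    "shift_snd G x (shift_snd G x b e) e' = shift_snd G x b (e \<otimes> e')"
proof -
  show "shift_fst G (shift_fst G a e) e' = shift_fst G a (e \<otimes> e')"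
    unfolding shift_fst_def using a e by (simp add: A.m_ac)
  define f f' where "f = x \<otimes> inv e \<otimes> inv x" and "f' = x \<otimes> inv e' \<otimes> inv x"
  have "inv (e \<otimes> e') = inv e \<otimes> inv e'"
    using e by (simp add: inv_mult_group A_comm)
  then have "x \<otimes> inv (e \<otimes> e') \<otimes> inv x = f \<otimes> f'"
    using e by (simp add: f_def f'_def conj_hom)
  moreover have "f \<in> A" "f' \<in> A"
    using e by (simp_all add: f_def f'_def)
  ultimately show "shift_snd G x (shift_snd G x b e) e' = shift_snd G x b (e \<otimes> e')"
    unfolding shift_snd_def using a b e by (simp add: A.m_ac flip: f_def f'_def)
qed

lemma step_in:
  assumes "a \<in> A" "b \<in> A"
  shows "twist G x y a b [^] (k::int) \<in> A" "step_fst G x y k a b \<in> A" "step_snd G x y k a b \<in> A"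
  using assms by (auto intro: step_in_normal)

lemma step_step:
  assumes "a \<in> A" "b \<in> A"
  shows "step_fst G x y l (step_fst G x y k a b) (step_snd G x y k a b) = step_fst G x y (k + l) a b"
    "step_snd G x y l (step_fst G x y k a b) (step_snd G x y k a b) = step_snd G x y (k + l) a b"
  using assms step_in[OF assms] step_closed(1)[of x y a b]
  by (simp_all add: step_fst_def step_snd_def twist_shift shift_shift int_pow_mult)

lemma step_0:
  assumes "a \<in> A" "b \<in> A"
  shows "step_fst G x y 0 a b = a" "step_snd G x y 0 a b = b"
  using assms by (simp_all add: step_fst_def step_snd_def shift_fst_def shift_snd_def)

text \<open>The new elements lie in the closure of the old ones, and the step with -k leads
  back.\<close>

lemma normal_closure_step:
  assumes "a \<in> A" "b \<in> A"
  shows "normal_closure G {step_fst G x y k a b, step_snd G x y k a b} = normal_closure G {a, b}"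
proof -
  have *: "normal_closure G {step_fst G x y k a b, step_snd G x y k a b} \<subseteq> normal_closure G {a, b}"
    if "a \<in> A" "b \<in> A" for k a b
  proof (rule normal_closure_minimal)
    show "normal_closure G {a, b} \<lhd> G"
      using that by (intro normal_normal_closure) simp
    then show "{step_fst G x y k a b, step_snd G x y k a b} \<subseteq> normal_closure G {a, b}"
      using normal_closure_incl[of "{a, b}"] by (simp add: normal.step_in_normal)
  qed
  from *[of "step_fst G x y k a b" "step_snd G x y k a b" "- k"] *[OF assms, of k] assms
  show ?thesis
    by (auto simp: step_in step_step step_0)
qed

lemma AC_shift:
  assumes "a \<in> A" "b \<in> A" "c \<in> A" and e: "e \<in> normal_closure G {c}"
  shows "AC_equivalent G [a, b, c] [shift_fst G a e, shift_snd G x b e, c]"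
proof -
  let ?N = "normal_closure G {c}"
  interpret N: normal ?N G
    using assms by (intro normal_normal_closure) simp
  have *: "h \<in> normal_closure G {[u, v, c] ! j | j. j < length [u, v, c] \<and> j \<noteq> i}"
    if "h \<in> ?N" "i < 2" for h u v i
  proof -
    have "c \<in> {[u, v, c] ! j | j. j < length [u, v, c] \<and> j \<noteq> i}"
      by (rule CollectI, rule exI[of _ 2]) (use that in simp)
    then show ?thesis
      using that(1) unfolding normal_closure_def by blast
  qed
  have eA: "e \<in> A"
    using normal_closure_minimal[OF normal_axioms, of "{c}"] assms by auto
  have sh: "shift_fst G a e \<in> A" "shift_snd G x b e \<in> A"
    using assms eA by (simp_all add: shift_closed)
  have "e \<otimes> e \<in> ?N" "e \<otimes> (x \<otimes> inv e \<otimes> inv x) \<in> ?N"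
    using e by (simp_all add: N.inv_op_closed2)
  note N = *[OF this(1), of 0 a b] *[OF this(2), of 1 "shift_fst G a e" b]
  have "AC_equivalent G [a, b, c] [shift_fst G a e, b, c]"
    using AC_mult_normal_closure[of 0 "[a, b, c]" a, OF _ _ _ N(1)] assms
    by (simp add: shift_fst_def)
  also have "AC_equivalent G \<dots> [shift_fst G a e, shift_snd G x b e, c]"
    using AC_mult_normal_closure[of 1 "[shift_fst G a e, b, c]" b, OF _ _ _ N(2)] assms sh
    by (simp add: shift_snd_def)
  finally show ?thesis .
qed

lemma AC_mult_twist:
  assumes "a \<in> A" "b \<in> A" "c \<in> A"
  shows "AC_equivalent G [a, b, c] [a, b, c \<otimes> twist G x y a b [^] (k::int)]"
proof -
  have "twist G x y a b [^] k \<in> normal_closure G {[a, b, c] ! j | j. j < length [a, b, c] \<and> j \<noteq> 2}"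
    (is "_ \<in> normal_closure G ?B")
    unfolding normal_closure_def
  proof (rule InterI)
    fix N assume "N \<in> {N. N \<lhd> G \<and> ?B \<subseteq> N}"
    moreover have "a \<in> ?B"
      by (rule CollectI, rule exI[of _ 0]) simp
    moreover have "b \<in> ?B"
      by (rule CollectI, rule exI[of _ 1]) simp
    ultimately have "N \<lhd> G" "a \<in> N" "b \<in> N" by blast+
    then show "twist G x y a b [^] k \<in> N"
      by (simp add: normal.step_in_normal)
  qed
  from AC_mult_normal_closure[of 2 "[a, b, c]" c, OF _ _ _ this] assms show ?thesis
    by simp
qed

text \<open>A third entry c turns the step into elementary moves: replace c by c + k w, add c + k w
  along the column, subtract k w from the third entry, which works as w has not changed, and finally
  subtract c along the column. The third entry is restored.\<close>

lemma AC_step: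
  assumes "a \<in> A" "b \<in> A" "c \<in> A"
  shows "AC_equivalent G [a, b, c] [step_fst G x y k a b, step_snd G x y k a b, c]"
proof -
  define d where "d = twist G x y a b [^] k"
  have d: "d \<in> A"
    unfolding d_def using step_in assms by blast
  define a' b' where "a' = shift_fst G a (c \<otimes> d)" and "b' = shift_snd G x b (c \<otimes> d)"
  have ab': "a' \<in> A" "b' \<in> A"
    using assms d by (simp_all add: a'_def b'_def shift_closed)
  have "AC_equivalent G [a, b, c] [a, b, c \<otimes> d]"
    unfolding d_def by (rule AC_mult_twist[OF assms])
  also have "AC_equivalent G \<dots> [a', b', c \<otimes> d]"
    unfolding a'_def b'_def using assms d normal_closure_incl[of "{c \<otimes> d}"]
    by (intro AC_shift) simp_all
  also have "AC_equivalent G \<dots> [a', b', c \<otimes> d \<otimes> twist G x y a' b' [^] (- k)]"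
    using ab' assms d by (intro AC_mult_twist) simp_all
  also have "twist G x y a' b' = twist G x y a b"
    using assms d by (simp add: a'_def b'_def twist_shift)
  also have "c \<otimes> d \<otimes> twist G x y a b [^] (- k) = c"
    using assms d step_closed(1)[of x y a b] by (simp add: int_pow_neg m_assoc flip: d_def)
  also have "AC_equivalent G [a', b', c] [shift_fst G a' (inv c), shift_snd G x b' (inv c), c]"
  proof (rule AC_shift)
    interpret N: normal "normal_closure G {c}" G
      using assms by (intro normal_normal_closure) simp
    show "inv c \<in> normal_closure G {c}"
      using normal_closure_incl[of "{c}"] by simp
  qed (use ab' assms in simp_all)
  also have "[shift_fst G a' (inv c), shift_snd G x b' (inv c), c]
      = [step_fst G x y k a b, step_snd G x y k a b, c]"
  proof -
    have "c \<otimes> d \<otimes> inv c = d"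
      using assms d A_comm[of d "inv c"] by (simp add: m_assoc)
    then show ?thesis
      using assms d by (simp_all add: a'_def b'_def shift_shift step_fst_def step_snd_def flip: d_def)
  qed
  finally show ?thesis .
qed

end

text \<open>The commutator of x and y lies in the abelian group A and so acts trivially on it; hence
  the actions of x and y commute.\<close>

lemma (in abelian_normal) conj_commute:
  assumes "commutator G x y \<in> A" "m \<in> A"
  shows "x \<otimes> (y \<otimes> m \<otimes> inv y) \<otimes> inv x = y \<otimes> (x \<otimes> m \<otimes> inv x) \<otimes> inv y"
proof -
  define c where "c = commutator G x y"
  have c: "c \<in> A" "c \<in> carrier G"
    using assms by (simp_all add: c_def)
  have m: "m \<in> carrier G" using assms by simp
  define m' where "m' = y \<otimes> (x \<otimes> m \<otimes> inv x) \<otimes> inv y"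
  have m': "m' \<in> A"
    unfolding m'_def using assms by simp
  have xy: "x \<otimes> y = c \<otimes> (y \<otimes> x)"
    unfolding c_def commutator_def by (simp add: m_assoc)
  have "x \<otimes> (y \<otimes> m \<otimes> inv y) \<otimes> inv x = (x \<otimes> y) \<otimes> m \<otimes> inv (x \<otimes> y)"
    using m by (simp add: m_assoc inv_mult_group)
  also have "\<dots> = c \<otimes> m' \<otimes> inv c"
    unfolding xy m'_def using m c by (simp add: m_assoc inv_mult_group)
  also have "\<dots> = m'"
    using c m' A_comm[of m' "inv c"] by (simp add: m_assoc)
  finally show ?thesis unfolding m'_def .
qed

text \<open>In module notation [r, x] is (1 - x) r, and the exponent \<open>inv y\<close> is the
  action of y. The entries are r + 2 y ((x - 1) r + 2 b) and b + y (1 - x) ((x - 1) r + 2 b); in the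
  second one x and y are interchanged by means of \<open>xy\<close>.\<close>

lemma (in abelian_normal) step_1:
  assumes xy: "commutator G x y \<in> A" and r: "r \<in> A" and b: "b \<in> A"
  shows "r \<otimes> conj_pow G (commutator G r x) (-2) (inv y) \<otimes> conj_pow G b 4 (inv y)
      = step_fst G x y 1 r b" (is ?fst)
    and "conj_pow G (commutator G (commutator G r x) x) (-1) (inv y)
      \<otimes> b \<otimes> conj_pow G (commutator G b x) 2 (inv y) = step_snd G x y 1 r b" (is ?snd)
proof -
  have pow2: "g [^] (2::int) = g \<otimes> g" if "g \<in> carrier G" for g
    using that int_pow_mult[of g 1 1] by simp
  have pow4: "g [^] (4::int) = g \<otimes> g \<otimes> (g \<otimes> g)" if "g \<in> carrier G" for g
    using that int_pow_mult[of g 2 2] by (simp add: pow2)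
  \<comment> \<open>Digits count conjugations by x and primes mark inverses, except that
    \<open>b1\<close> is the conjugate of the inverse of b.\<close>
  define r' b' r1 r1' r2 r2' b1 where "r' = inv r" and "b' = inv b" and "r1 = x \<otimes> r \<otimes> inv x"
    and "r1' = x \<otimes> inv r \<otimes> inv x" and "r2 = x \<otimes> r1 \<otimes> inv x" and "r2' = x \<otimes> r1' \<otimes> inv x"
    and "b1 = x \<otimes> inv b \<otimes> inv x"
  note defs = this
  have A: "r' \<in> A" "b' \<in> A" "r1 \<in> A" "r1' \<in> A" "r2 \<in> A" "r2' \<in> A" "b1 \<in> A"
    using r b by (simp_all add: defs)
  have inv1: "inv r1 = r1'" "inv r1' = r1" "inv r2 = r2'" "inv r' = r" "inv r2' = r2"
    using r b A(3,4) by (simp_all add: defs conj_inv)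
  have comm1: "commutator G r x = r \<otimes> r1'"
    using r by (simp add: commutator_def r1'_def m_assoc)
  have comm2: "commutator G (r \<otimes> r1') x = r \<otimes> r1' \<otimes> (r1' \<otimes> r2)"
  proof -
    have "inv (r \<otimes> r1') = r' \<otimes> r1"
      using r A by (simp add: inv_mult_group inv1 A_comm flip: r'_def)
    moreover have "commutator G (r \<otimes> r1') x = r \<otimes> r1' \<otimes> (x \<otimes> inv (r \<otimes> r1') \<otimes> inv x)"
      using r A by (simp add: commutator_def m_assoc)
    moreover have "x \<otimes> (r' \<otimes> r1) \<otimes> inv x = r1' \<otimes> r2"
      using A by (simp add: conj_hom) (simp add: r1'_def r2_def r'_def)
    ultimately show ?thesis by simp
  qed
  have comm3: "commutator G b x = b \<otimes> b1"
    using b by (simp add: commutator_def b1_def m_assoc)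
  have inv_comm1: "inv (r \<otimes> r1' \<otimes> (r \<otimes> r1')) = r' \<otimes> r1 \<otimes> (r' \<otimes> r1)"
    using r A by (simp add: inv_mult_group inv1 A.m_ac flip: r'_def)
  have inv_comm2: "inv (r \<otimes> r1' \<otimes> (r1' \<otimes> r2)) = r' \<otimes> r1 \<otimes> (r1 \<otimes> r2')"
    using r A by (simp add: inv_mult_group inv1 A.m_ac flip: r'_def)
  define m where "m = r1 \<otimes> r' \<otimes> (b \<otimes> b)"
  have mA: "m \<in> A"
    unfolding m_def using A b by simp
  have twist: "twist G x y r b = y \<otimes> m \<otimes> inv y"
    by (simp add: twist_def m_def r1_def r'_def)
  have neg: "g [^] (-2::int) = inv (g \<otimes> g)" "g [^] (-1::int) = inv g" if "g \<in> carrier G" for g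
    using that int_pow_neg[of g 2] int_pow_neg[of g 1] by (simp_all add: pow2)
  have "r \<otimes> conj_pow G (commutator G r x) (-2) (inv y) \<otimes> conj_pow G b 4 (inv y)
      = r \<otimes> (y \<otimes> (r' \<otimes> r1 \<otimes> (r' \<otimes> r1)) \<otimes> inv y \<otimes> (y \<otimes> (b \<otimes> b \<otimes> (b \<otimes> b)) \<otimes> inv y))"
    using r b A by (simp add: conj_pow_def comm1 neg pow4 inv_comm1) (simp add: m_assoc)
  also have "\<dots> = r \<otimes> (y \<otimes> (r' \<otimes> r1 \<otimes> (r' \<otimes> r1) \<otimes> (b \<otimes> b \<otimes> (b \<otimes> b))) \<otimes> inv y)"
    using r b A by (simp add: conj_hom)
  also have "r' \<otimes> r1 \<otimes> (r' \<otimes> r1) \<otimes> (b \<otimes> b \<otimes> (b \<otimes> b)) = m \<otimes> m"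
    unfolding m_def using b A by (simp add: A.m_ac)
  finally show ?fst
    using mA r by (simp add: step_fst_def shift_fst_def twist conj_hom)
  have minv: "inv m = r1' \<otimes> r \<otimes> (b' \<otimes> b')"
    unfolding m_def using A b r by (simp add: inv_mult_group inv1 A.m_ac flip: b'_def)
  have "x \<otimes> (r1' \<otimes> r \<otimes> (b' \<otimes> b')) \<otimes> inv x = r2' \<otimes> r1 \<otimes> (b1 \<otimes> b1)"
    using A r by (simp add: conj_hom) (simp add: r2'_def r1_def b1_def b'_def)
  then have conj: "x \<otimes> (y \<otimes> inv m \<otimes> inv y) \<otimes> inv x = y \<otimes> (r2' \<otimes> r1 \<otimes> (b1 \<otimes> b1)) \<otimes> inv y"
    using conj_commute[OF xy m_inv_closed[OF mA]] by (simp add: minv)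
  have "conj_pow G (commutator G (commutator G r x) x) (-1) (inv y)
      \<otimes> b \<otimes> conj_pow G (commutator G b x) 2 (inv y)
      = y \<otimes> (r' \<otimes> r1 \<otimes> (r1 \<otimes> r2')) \<otimes> inv y \<otimes> b \<otimes> (y \<otimes> (b \<otimes> b1 \<otimes> (b \<otimes> b1)) \<otimes> inv y)"
    using r b A by (simp add: conj_pow_def comm1 comm2 comm3 neg pow2 inv_comm2)
  also have "\<dots> = b \<otimes> (y \<otimes> (r' \<otimes> r1 \<otimes> (r1 \<otimes> r2')) \<otimes> inv y \<otimes> (y \<otimes> (b \<otimes> b1 \<otimes> (b \<otimes> b1)) \<otimes> inv y))"
  proof -
    have st: "y \<otimes> (r' \<otimes> r1 \<otimes> (r1 \<otimes> r2')) \<otimes> inv y \<in> A" "y \<otimes> (b \<otimes> b1 \<otimes> (b \<otimes> b1)) \<otimes> inv y \<in> A"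
      using A b by (simp_all del: m_assoc)
    show ?thesis
      by (simp only: A_comm[OF st(1) b] A.m_assoc[OF b st])
  qed
  also have "\<dots> = b \<otimes> (y \<otimes> (r' \<otimes> r1 \<otimes> (r1 \<otimes> r2') \<otimes> (b \<otimes> b1 \<otimes> (b \<otimes> b1))) \<otimes> inv y)"
    using r b A by (simp add: conj_hom)
  also have "r' \<otimes> r1 \<otimes> (r1 \<otimes> r2') \<otimes> (b \<otimes> b1 \<otimes> (b \<otimes> b1)) = m \<otimes> (r2' \<otimes> r1 \<otimes> (b1 \<otimes> b1))"
    unfolding m_def using b A by (simp add: A.m_ac)
  finally show ?snd
    using mA A r b by (simp add: step_snd_def shift_snd_def twist conj_inv conj conj_hom)
qed

section \<open>Homomorphisms and the quotient by the derived subgroup\<close>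

context group_hom
begin

lemma step_hom:
  assumes "x \<in> carrier G" "y \<in> carrier G" "a \<in> carrier G" "b \<in> carrier G"
  shows "h (step_fst G x y k a b) = step_fst H (h x) (h y) k (h a) (h b)"
    "h (step_snd G x y k a b) = step_snd H (h x) (h y) k (h a) (h b)"
proof -
  have "h (twist G x y a b) = twist H (h x) (h y) (h a) (h b)"
    using assms by (simp add: twist_def)
  then show "h (step_fst G x y k a b) = step_fst H (h x) (h y) k (h a) (h b)"
    "h (step_snd G x y k a b) = step_snd H (h x) (h y) k (h a) (h b)"
    using assms G.step_closed(1)[OF assms]
    by (simp_all add: step_fst_def step_snd_def shift_fst_def shift_snd_def hom_int_pow)
qed

lemma commutator_hom:
  "a \<in> carrier G \<Longrightarrow> b \<in> carrier G \<Longrightarrow> h (commutator G a b) = commutator H (h a) (h b)"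
  by (simp add: commutator_def)

lemma AC_move_hom:
  assumes "AC_move G y z" "set y \<subseteq> carrier G"
  shows "AC_move H (map h y) (map h z)" "set z \<subseteq> carrier G"
proof -
  from assms have "AC_move H (map h y) (map h z) \<and> set z \<subseteq> carrier G"
  proof cases
    case (AC1 i j)
    with assms(2) have "y ! i \<in> carrier G" "y ! j \<in> carrier G" by auto
    with AC1 assms(2) AC_move.AC1[of i "map h y" j H] show ?thesis
      by (auto simp: map_update dest!: set_update_subset_insert[THEN subsetD])
  next
    case (AC2 i)
    with assms(2) have "y ! i \<in> carrier G" by auto
    with AC2 assms(2) AC_move.AC2[of i "map h y" H] show ?thesis
      by (auto simp: map_update dest!: set_update_subset_insert[THEN subsetD])
  next
    case (AC3 i g)
    with assms(2) have "y ! i \<in> carrier G" by auto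
    with AC3 assms(2) AC_move.AC3[of i "map h y" "h g" H] show ?thesis
      by (auto simp: map_update dest!: set_update_subset_insert[THEN subsetD])
  qed
  then show "AC_move H (map h y) (map h z)" "set z \<subseteq> carrier G" by auto
qed

lemma AC_equivalent_hom:
  assumes "AC_equivalent G y z" "set y \<subseteq> carrier G"
  shows "AC_equivalent H (map h y) (map h z)"
proof -
  from assms have "AC_equivalent H (map h y) (map h z) \<and> set z \<subseteq> carrier G"
    unfolding AC_equivalent_def
    by induction (use AC_move_hom in \<open>auto intro: rtranclp.rtrancl_into_rtrancl\<close>)
  then show ?thesis by blast
qed

lemma normal_closure_image:
  assumes surj: "h ` carrier G = carrier H" and B: "B \<subseteq> carrier G"
  shows "normal_closure H (h ` B) = h ` normal_closure G B"
proof
  have "h ` normal_closure G B \<lhd> H"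
    using normal.surj_hom_normal_subgroup[OF G.normal_normal_closure[OF B] group_hom_axioms surj] .
  then show "normal_closure H (h ` B) \<subseteq> h ` normal_closure G B"
    using G.normal_closure_incl by (intro H.normal_closure_minimal) auto
next
  have XH: "h ` B \<subseteq> carrier H"
    using B by auto
  interpret N: normal "normal_closure H (h ` B)" H
    by (rule H.normal_normal_closure[OF XH])
  let ?N = "{g \<in> carrier G. h g \<in> normal_closure H (h ` B)}"
  have "subgroup ?N G"
    by (rule G.subgroupI) auto
  then have "?N \<lhd> G"
    by (auto simp: G.normal_inv_iff N.inv_op_closed2)
  moreover have "B \<subseteq> ?N"
    using B H.normal_closure_incl[of "h ` B"] by auto
  ultimately show "h ` normal_closure G B \<subseteq> normal_closure H (h ` B)"
    using G.normal_closure_minimal[of ?N B] by auto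
qed

end

section \<open>Universal properties of the free group and of F/[R,R]\<close>

lemma free_group_simps:
  "u \<otimes>\<^bsub>free_group S\<^esub> v = foldr lmult u v" "\<one>\<^bsub>free_group S\<^esub> = []"
  "carrier (free_group S) = {w. reduced w \<and> fst ` set w \<subseteq> S}"
  by (simp_all add: free_group_def)

lemma gen_closed [simp]: "a \<in> S \<Longrightarrow> gen a \<in> carrier (free_group S)"
  by (simp add: free_group_simps gen_def reduced_def)

lemma free_group_mono: "S \<subseteq> T \<Longrightarrow> group_hom (free_group S) (free_group T) (\<lambda>w. w)"
  by (auto simp: group_hom_def group_hom_axioms_def group_free_group hom_def free_group_simps
      reduced_foldr dest!: set_foldr_lmult[THEN subsetD])

definition free_group_lift :: "('b, 'c) monoid_scheme \<Rightarrow> ('a \<Rightarrow> 'b) \<Rightarrow> 'a word \<Rightarrow> 'b" where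
  "free_group_lift G h w =
     foldr (\<lambda>(a, e) g. (if e then h a else inv\<^bsub>G\<^esub> (h a)) \<otimes>\<^bsub>G\<^esub> g) w \<one>\<^bsub>G\<^esub>"

text \<open>A cancelling pair of letters evaluates to the identity, so the cancellation done by
  \<open>lmult\<close> does not change the value of a word.\<close>

lemma (in group) free_group_lift:
  assumes h: "\<And>a. a \<in> S \<Longrightarrow> h a \<in> carrier G"
  shows "group_hom (free_group S) G (free_group_lift G h)"
    and "a \<in> S \<Longrightarrow> free_group_lift G h (gen a) = h a"
proof -
  let ?h = "free_group_lift G h"
  define l where "l = (\<lambda>(a, e). if e then h a else inv (h a))"
  have simps [simp]: "?h [] = \<one>" "?h (p # w) = l p \<otimes> ?h w" for p w
    by (simp_all add: free_group_lift_def l_def split: prod.split)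
  have l [simp]: "fst p \<in> S \<Longrightarrow> l p \<in> carrier G" for p
    using h by (auto simp: l_def split: prod.split)
  have closed: "fst ` set w \<subseteq> S \<Longrightarrow> ?h w \<in> carrier G" for w
    by (induction w) auto
  have cancel: "l p \<otimes> l q = \<one>" if "cancelling p q" "fst p \<in> S" for p q
    using that h by (auto simp: cancelling_def l_def split: prod.splits)
  have lmult: "?h (lmult p w) = l p \<otimes> ?h w" if p: "fst p \<in> S" and w: "fst ` set w \<subseteq> S" for p w
  proof (cases w)
    case (Cons q v)
    have "l p \<otimes> (l q \<otimes> ?h v) = (l p \<otimes> l q) \<otimes> ?h v"
      using p w Cons closed by (simp add: m_assoc)
    then show ?thesis
      using Cons cancel[of p q] p w closed[of v] by auto
  qed simp
  have mult: "?h (foldr lmult u v) = ?h u \<otimes> ?h v"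
    if "fst ` set u \<subseteq> S" "fst ` set v \<subseteq> S" for u v
    using that
  proof (induction u)
    case (Cons p u)
    have "fst ` set (foldr lmult u v) \<subseteq> fst ` set u \<union> fst ` set v"
      using image_mono[OF set_foldr_lmult[of u v], of fst] by (simp only: image_Un)
    with Cons.prems have "fst ` set (foldr lmult u v) \<subseteq> S"
      by (simp only: list.set image_insert) blast
    with Cons show ?case
      using closed by (simp add: lmult m_assoc)
  qed (use closed in simp)
  show "group_hom (free_group S) G ?h"
    unfolding group_hom_def group_hom_axioms_def
    by (auto simp: group_free_group is_group hom_def free_group_simps closed mult)
  show "a \<in> S \<Longrightarrow> ?h (gen a) = h a"
    using h by (simp add: gen_def) (simp add: l_def)
qed

locale relation_quotient =
  fixes S :: "'a set" and R :: "'a word set"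
  assumes R: "R \<lhd> free_group S"
begin

sublocale F: group "free_group S"
  by (rule group_free_group)

lemma derived_normal: "derived (free_group S) R \<lhd> free_group S"
  by (rule F.derived_is_normal[OF R])

lemma R_closed: "w \<in> R \<Longrightarrow> w \<in> carrier (free_group S)"
  using normal_imp_subgroup[OF R] by (rule subgroup.mem_carrier)

sublocale proj: group_hom "free_group S" "quot_RR S R" "proj_RR S R"
proof -
  interpret K: normal "derived (free_group S) R" "free_group S"
    by (rule derived_normal)
  show "group_hom (free_group S) (quot_RR S R) (proj_RR S R)"
    unfolding group_hom_def group_hom_axioms_def quot_RR_def
    using K.r_coset_hom_Mod K.factorgroup_is_group F.is_group
    by (simp add: proj_RR_def[abs_def])
qed

lemma proj_surj: "proj_RR S R ` carrier (free_group S) = carrier (quot_RR S R)"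
  by (simp add: quot_RR_def carrier_FactGroup proj_RR_def[abs_def])

lemma abelian_normal_proj:
  assumes "x \<in> carrier (free_group S)" "y \<in> carrier (free_group S)"
  shows "abelian_normal (proj_RR S R ` R) (quot_RR S R) (proj_RR S R x) (proj_RR S R y)"
proof -
  have "proj_RR S R ` R \<lhd> quot_RR S R"
    by (rule normal.surj_hom_normal_subgroup[OF R proj.group_hom_axioms proj_surj])
  moreover have "proj_RR S R u \<otimes>\<^bsub>quot_RR S R\<^esub> proj_RR S R v = proj_RR S R v \<otimes>\<^bsub>quot_RR S R\<^esub> proj_RR S R u"
    if "u \<in> R" "v \<in> R" for u v
  proof -
    let ?c = "commutator (free_group S) u v"
    have uv: "u \<in> carrier (free_group S)" "v \<in> carrier (free_group S)"
      using that R_closed by auto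
    have c: "?c \<in> derived (free_group S) R"
      unfolding derived_def commutator_def by (rule generate.incl) (use that in blast)
    have "proj_RR S R ?c = \<one>\<^bsub>quot_RR S R\<^esub>"
      unfolding proj_RR_def quot_RR_def one_FactGroup
      using F.coset_join2[OF _ normal_imp_subgroup[OF derived_normal] c] uv
      by (simp add: commutator_def)
    then have "proj_RR S R (?c \<otimes>\<^bsub>free_group S\<^esub> (v \<otimes>\<^bsub>free_group S\<^esub> u)) = proj_RR S R (v \<otimes>\<^bsub>free_group S\<^esub> u)"
      using uv by (simp add: commutator_def)
    moreover have "?c \<otimes>\<^bsub>free_group S\<^esub> (v \<otimes>\<^bsub>free_group S\<^esub> u) = u \<otimes>\<^bsub>free_group S\<^esub> v"
      using uv by (simp add: commutator_def F.m_assoc)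
    ultimately show ?thesis
      using uv by simp
  qed
  ultimately show ?thesis
    using assms unfolding abelian_normal_def abelian_normal_axioms_def by auto
qed

text \<open>Universal property of F/[R,R]: if the images of elements of R commute, then the kernel
  contains [R,R].\<close>

lemma quotient_lift:
  assumes \<phi>: "group_hom (free_group S) G \<phi>"
    and comm: "\<And>u v. u \<in> R \<Longrightarrow> v \<in> R \<Longrightarrow> \<phi> u \<otimes>\<^bsub>G\<^esub> \<phi> v = \<phi> v \<otimes>\<^bsub>G\<^esub> \<phi> u"
  obtains \<psi> where "group_hom (quot_RR S R) G \<psi>"
    "\<And>w. w \<in> carrier (free_group S) \<Longrightarrow> \<psi> (proj_RR S R w) = \<phi> w"
proof -
  interpret \<phi>: group_hom "free_group S" G \<phi> by (rule \<phi>)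
  interpret K: normal "derived (free_group S) R" "free_group S"
    by (rule derived_normal)
  have "derived_set (free_group S) R \<subseteq> kernel (free_group S) G \<phi>"
  proof clarify
    fix u v assume uv: "u \<in> R" "v \<in> R"
    then have "\<phi> u \<in> carrier G" "\<phi> v \<in> carrier G"
      using R_closed by auto
    with comm[OF uv] have "\<phi> u \<otimes>\<^bsub>G\<^esub> \<phi> v \<otimes>\<^bsub>G\<^esub> inv\<^bsub>G\<^esub> \<phi> u \<otimes>\<^bsub>G\<^esub> inv\<^bsub>G\<^esub> \<phi> v = \<one>\<^bsub>G\<^esub>"
      by (simp add: \<phi>.H.m_assoc)
    then show "u \<otimes>\<^bsub>free_group S\<^esub> v \<otimes>\<^bsub>free_group S\<^esub> inv\<^bsub>free_group S\<^esub> u \<otimes>\<^bsub>free_group S\<^esub> inv\<^bsub>free_group S\<^esub> v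
        \<in> kernel (free_group S) G \<phi>"
      using uv R_closed by (simp add: kernel_def)
  qed
  then have K: "derived (free_group S) R \<subseteq> kernel (free_group S) G \<phi>"
    unfolding derived_def by (rule F.generate_subgroup_incl[OF _ \<phi>.subgroup_kernel])
  have "\<phi> u = \<phi> v"
    if uv: "u \<in> carrier (free_group S)" "v \<in> carrier (free_group S)"
      and eq: "derived (free_group S) R #>\<^bsub>free_group S\<^esub> u = derived (free_group S) R #>\<^bsub>free_group S\<^esub> v" for u v
  proof -
    have "u \<in> derived (free_group S) R #>\<^bsub>free_group S\<^esub> v"
      using F.rcos_self[OF uv(1) K.subgroup_axioms] by (simp add: eq)
    then obtain k where "k \<in> derived (free_group S) R" "u = k \<otimes>\<^bsub>free_group S\<^esub> v"
      by (auto simp: r_coset_def)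
    with K uv show ?thesis by (auto simp: kernel_def)
  qed
  from FactGroup_universal[OF \<phi>.homh derived_normal this] obtain \<psi> where
    "\<psi> \<in> hom (quot_RR S R) G" "\<And>w. w \<in> carrier (free_group S) \<Longrightarrow> \<psi> (proj_RR S R w) = \<phi> w"
    unfolding quot_RR_def proj_RR_def by blast
  then show thesis
    by (intro that) (auto simp: group_hom_def group_hom_axioms_def \<phi>.H.is_group proj.H.is_group)
qed

end

section \<open>Stable equivalence with one additional generator\<close>

lemma stable_AC_of_AC:
  assumes "AC_equivalent (quot_RR S R) y z"
  shows "stable_AC_move\<^sup>*\<^sup>* (S, R, y) (S, R, z)"
  using assms unfolding AC_equivalent_def
  by induction (auto intro: rtranclp.rtrancl_into_rtrancl stable_AC_move.AC123)

text \<open>The new generator lies in the enlarged R and serves as the third entry in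
  \<open>AC_step\<close>, which returns it unchanged, so it can be removed again. The step is formed
  on words, since words are what \<open>adjoin\<close> carries between the quotients.\<close>

lemma (in relation_quotient) stably_AC_equivalent_step:
  assumes v: "v \<notin> S" and x: "x \<in> carrier (free_group S)" and y: "y \<in> carrier (free_group S)"
    and a: "a \<in> R" and b: "b \<in> R"
  shows "stably_AC_equivalent S R (map (proj_RR S R) [a, b])
    (map (proj_RR S R) [step_fst (free_group S) x y k a b, step_snd (free_group S) x y k a b])"
    (is "stably_AC_equivalent S R _ (map (proj_RR S R) [?a, ?b])")
proof -
  let ?S = "insert v S"
  let ?R = "normal_closure (free_group ?S) (insert (gen v) R)"
  interpret incl: group_hom "free_group S" "free_group ?S" "\<lambda>w. w"
    by (rule free_group_mono) auto
  have sub: "insert (gen v) R \<subseteq> carrier (free_group ?S)"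
    using R_closed incl.hom_closed by auto
  interpret S': relation_quotient ?S ?R
    by (rule relation_quotient.intro, rule incl.H.normal_normal_closure[OF sub])
  have R': "insert (gen v) R \<subseteq> ?R"
    by (rule incl.H.normal_closure_incl)
  interpret A: abelian_normal "proj_RR ?S ?R ` ?R" "quot_RR ?S ?R" "proj_RR ?S ?R x" "proj_RR ?S ?R y"
    using x y incl.hom_closed by (intro S'.abelian_normal_proj) auto
  have carrier: "a \<in> carrier (free_group S)" "b \<in> carrier (free_group S)"
    "?a \<in> carrier (free_group S)" "?b \<in> carrier (free_group S)"
    using x y a b R_closed by (simp_all add: F.step_closed)
  have *: "proj_RR ?S ?R ?a = step_fst (quot_RR ?S ?R) (proj_RR ?S ?R x) (proj_RR ?S ?R y) k
        (proj_RR ?S ?R a) (proj_RR ?S ?R b)"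
    "proj_RR ?S ?R ?b = step_snd (quot_RR ?S ?R) (proj_RR ?S ?R x) (proj_RR ?S ?R y) k
        (proj_RR ?S ?R a) (proj_RR ?S ?R b)"
    using x y carrier incl.hom_closed incl.step_hom[of x y a b k] S'.proj.step_hom[of x y a b k] by auto
  have adjoin: "adjoin (S, R, map (proj_RR S R) ws) (?S, ?R, map (proj_RR ?S ?R) (ws @ [gen v]))"
    if "set ws \<subseteq> carrier (free_group S)" for ws
    using adjoin.intros[OF R v that refl] .
  have "stable_AC_move (S, R, map (proj_RR S R) [a, b]) (?S, ?R, map (proj_RR ?S ?R) ([a, b] @ [gen v]))"
    by (rule stable_AC_move.AC4, rule adjoin) (use carrier in simp)
  also have "stable_AC_move\<^sup>*\<^sup>* \<dots> (?S, ?R, map (proj_RR ?S ?R) ([?a, ?b] @ [gen v]))"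
    using A.AC_step[of "proj_RR ?S ?R a" "proj_RR ?S ?R b" "proj_RR ?S ?R (gen v)" k] a b R'
    by (intro stable_AC_of_AC) (simp add: * subset_iff)
  also have "stable_AC_move \<dots> (S, R, map (proj_RR S R) [?a, ?b])"
    by (rule stable_AC_move.AC5, rule adjoin) (use carrier in simp)
  finally show ?thesis
    by (simp add: stably_AC_equivalent_def)
qed

section \<open>Affine maps over Laurent series\<close>

definition laurent_unit :: "'a::idom fls \<Rightarrow> bool" where
  "laurent_unit u \<longleftrightarrow> (\<exists>i e. e dvd 1 \<and> u = X_intpow i * fps_to_fls e)"

lemma laurent_unit_1 [simp]: "laurent_unit 1"
  unfolding laurent_unit_def by (rule exI[of _ 0], rule exI[of _ 1]) simp

lemma laurent_unit_X_intpow [simp]: "laurent_unit (X_intpow i)"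
  unfolding laurent_unit_def by (rule exI[of _ i], rule exI[of _ 1]) simp

lemma laurent_unit_mult [simp]:
  assumes "laurent_unit u" "laurent_unit v"
  shows "laurent_unit (u * v)"
proof -
  from assms obtain i e j f where "e dvd 1" "u = X_intpow i * fps_to_fls e"
    "f dvd 1" "v = X_intpow j * fps_to_fls f"
    by (auto simp: laurent_unit_def)
  then have "u * v = X_intpow (i + j) * fps_to_fls (e * f)" "e * f dvd 1"
    using mult_dvd_mono[of e 1 f 1] by (simp_all add: X_intpow_add fls_times_fps_to_fls ac_simps)
  then show ?thesis
    unfolding laurent_unit_def by blast
qed

lemma laurent_unit_inverse:
  assumes "laurent_unit u"
  obtains v where "laurent_unit v" "u * v = 1"
proof -
  from assms obtain i e where e: "e dvd 1" "u = X_intpow i * fps_to_fls e"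
    by (auto simp: laurent_unit_def)
  from e(1) obtain f where f: "1 = e * f" by (auto simp: dvd_def)
  have "u * (X_intpow (- i) * fps_to_fls f) = X_intpow (i + - i) * fps_to_fls (e * f)"
    unfolding X_intpow_add fls_times_fps_to_fls e(2) by (simp add: ac_simps)
  then have "u * (X_intpow (- i) * fps_to_fls f) = 1"
    by (simp flip: f)
  moreover have "f dvd 1"
    using f by (metis dvd_triv_right)
  ultimately show ?thesis
    using that unfolding laurent_unit_def by blast
qed

text \<open>The triple \<open>(u, a, b)\<close> is the affine map \<open>v \<mapsto> u v + (a, b)\<close>.\<close>

definition affine_group :: "('a::idom fls \<times> 'a fls \<times> 'a fls) monoid" where
  "affine_group = \<lparr>carrier = {(u, a, b). laurent_unit u},
     monoid.mult = (\<lambda>(u, a, b) (v, c, d). (u * v, a + u * c, b + u * d)), one = (1, 0, 0)\<rparr>"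

lemma affine_group_simps [simp]:
  "(u, a, b) \<in> carrier affine_group \<longleftrightarrow> laurent_unit u"
  "(u, a, b) \<otimes>\<^bsub>affine_group\<^esub> (v, c, d) = (u * v, a + u * c, b + u * d)"
  "\<one>\<^bsub>affine_group\<^esub> = (1, 0, 0)"
  by (simp_all add: affine_group_def)

interpretation affine: group "affine_group :: ('a::idom fls \<times> 'a fls \<times> 'a fls) monoid"
proof (rule groupI)
  fix g assume "g \<in> carrier (affine_group :: ('a fls \<times> 'a fls \<times> 'a fls) monoid)"
  then obtain u a b where g: "g = (u, a, b)" "laurent_unit u"
    by (cases g) auto
  from g(2) obtain v where v: "laurent_unit v" "u * v = 1"
    by (rule laurent_unit_inverse)
  then show "\<exists>h\<in>carrier affine_group. h \<otimes>\<^bsub>affine_group\<^esub> g = \<one>\<^bsub>affine_group\<^esub>"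
    by (intro bexI[of _ "(v, - (v * a), - (v * b))"]) (simp_all add: g mult.commute)
qed (auto simp: algebra_simps)

lemma affine_inv [simp]: "inv\<^bsub>affine_group\<^esub> (1, a, b) = (1, - a, - b)"
  by (rule affine.inv_equality) simp_all

text \<open>Conjugation acts on translations through the linear part alone, so they form a module on
  which the group acts by scalars.\<close>

lemma affine_conj:
  assumes "laurent_unit u"
  shows "(u, c, d) \<otimes>\<^bsub>affine_group\<^esub> (1, a, b) \<otimes>\<^bsub>affine_group\<^esub> inv\<^bsub>affine_group\<^esub> (u, c, d)
    = (1, u * a, u * b)"
  by (rule affine.inv_solve_right'[THEN iffD2]) (use assms in \<open>simp_all add: algebra_simps\<close>)

lemma affine_pow: "(1, a, b) [^]\<^bsub>affine_group\<^esub> (k::int) = (1, of_int k * a, of_int k * b)"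
proof -
  have nat: "(1, a, b) [^]\<^bsub>affine_group\<^esub> (n::nat) = (1, of_nat n * a, of_nat n * b)" for n
    by (induction n) (simp_all add: algebra_simps)
  show ?thesis
    by (cases k rule: int_cases2) (simp_all add: int_pow_int nat affine.int_pow_neg)
qed

text \<open>Both coordinates are transformed by the same matrix, 1 + k v times the column (2, 1 - u)
  times the row (u - 1, 2), where u and v are the linear parts.\<close>

lemma affine_step:
  assumes "laurent_unit u" "laurent_unit v"
  defines "w \<equiv> \<lambda>a b. v * (u * a - a + 2 * b)"
  shows "step_fst affine_group (u, a, b) (v, c, d) k (1, a1, b1) (1, a2, b2)
      = (1, a1 + 2 * of_int k * w a1 a2, b1 + 2 * of_int k * w b1 b2)"
    "step_snd affine_group (u, a, b) (v, c, d) k (1, a1, b1) (1, a2, b2)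
      = (1, a2 + of_int k * (1 - u) * w a1 a2, b2 + of_int k * (1 - u) * w b1 b2)"
proof -
  have "(1, u * a1, u * b1) \<otimes>\<^bsub>affine_group\<^esub> inv\<^bsub>affine_group\<^esub> (1, a1, b1) \<otimes>\<^bsub>affine_group\<^esub>
      ((1, a2, b2) \<otimes>\<^bsub>affine_group\<^esub> (1, a2, b2)) = (1, u * a1 - a1 + 2 * a2, u * b1 - b1 + 2 * b2)"
    by simp
  then have twist: "twist affine_group (u, a, b) (v, c, d) (1, a1, b1) (1, a2, b2) = (1, w a1 a2, w b1 b2)"
    by (simp only: twist_def affine_conj[OF assms(1)] affine_conj[OF assms(2)] w_def)
  show "step_fst affine_group (u, a, b) (v, c, d) k (1, a1, b1) (1, a2, b2)
      = (1, a1 + 2 * of_int k * w a1 a2, b1 + 2 * of_int k * w b1 b2)"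
    by (simp add: step_fst_def shift_fst_def twist affine_pow)
  show "step_snd affine_group (u, a, b) (v, c, d) k (1, a1, b1) (1, a2, b2)
      = (1, a2 + of_int k * (1 - u) * w a1 a2, b2 + of_int k * (1 - u) * w b1 b2)"
    unfolding step_snd_def shift_snd_def twist affine_pow affine_inv affine_conj[OF assms(1)]
    by (simp add: algebra_simps)
qed

section \<open>AC-moves as left multiplications of matrices\<close>

definition matrix_pair :: "'a::idom fls^2^2 \<Rightarrow> ('a fls \<times> 'a fls \<times> 'a fls) list" where
  "matrix_pair B = [(1, B$1$1, B$1$2), (1, B$2$1, B$2$2)]"

text \<open>AC1 and AC2 are multiplications by constant invertible matrices. AC3 multiplies one row
  by the linear part s^l e of g, whatever the translation part is.\<close>

lemma AC_move_matrix_pair: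
  assumes "AC_move affine_group (matrix_pair B) z"
  obtains h where "z = matrix_pair (h ** B)" "\<And>g. dilation_word g \<Longrightarrow> dilation_word (h ** g)"
  using assms
proof cases
  case (AC1 i j)
  then have ij: "i = 0 \<and> j = 1 \<or> i = 1 \<and> j = 0"
    by (auto simp: matrix_pair_def less_Suc_eq)
  define k :: "'a fps^2^2" where "k = (if i = 0 then mat2 1 1 0 1 else mat2 1 0 1 1)"
  have "det k dvd 1"
    by (simp add: k_def det_2)
  moreover have "z = matrix_pair (laurent_scale 0 k ** B)"
    using ij AC1(1) by (auto simp: k_def matrix_pair_def mult_mat2_nth add.commute)
  ultimately show ?thesis
    using that dilation_word_scale by blast
next
  case (AC2 i)
  then have i: "i = 0 \<or> i = 1"
    by (auto simp: matrix_pair_def less_Suc_eq)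
  define k :: "'a fps^2^2" where "k = (if i = 0 then mat2 (- 1) 0 0 1 else mat2 1 0 0 (- 1))"
  have "det k dvd 1"
    by (simp add: k_def det_2)
  moreover have "z = matrix_pair (laurent_scale 0 k ** B)"
    using i AC2(1) by (auto simp: k_def matrix_pair_def mult_mat2_nth)
  ultimately show ?thesis
    using that dilation_word_scale by blast
next
  case (AC3 i g)
  then have i: "i = 0 \<or> i = 1"
    by (auto simp: matrix_pair_def less_Suc_eq)
  obtain u c d where g: "g = (u, c, d)" "laurent_unit u"
    using AC3(3) by (cases g) auto
  then obtain l e where u: "e dvd 1" "u = X_intpow l * fps_to_fls e"
    by (auto simp: laurent_unit_def)
  define h where "h = (if i = 0 then mat2 u 0 0 1 else mat2 1 0 0 u)"
  have "z = matrix_pair (h ** B)"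
    using i AC3(1) affine_conj[OF g(2), of c d, simplified]
    by (auto simp: g(1) h_def matrix_pair_def mult_mat2_nth)
  moreover have "dilation_word (h ** g)" if "dilation_word g" for g
    using that u by (simp add: h_def dilation_word_diag1 dilation_word_diag2)
  ultimately show ?thesis
    using that by blast
qed

lemma dilation_word_1: "dilation_word (mat 1)"
proof -
  have "laurent_scale 0 (mat 1 :: 'a fps^2^2) = mat 1"
    by (simp add: mat2_eq_iff) (simp add: mat_def)
  moreover have "reduced_matrix (mat 1 :: 'a fps^2^2)"
    by (simp add: reduced_matrix_def)
  ultimately show ?thesis
    unfolding dilation_word_def by metis
qed

lemma AC_equivalent_matrix_pair:
  assumes "AC_equivalent affine_group (matrix_pair B) z"
  obtains h where "dilation_word h" "z = matrix_pair (h ** B)"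
proof -
  from assms have "\<exists>h. dilation_word h \<and> z = matrix_pair (h ** B)"
    unfolding AC_equivalent_def
  proof induction
    case base
    show ?case
      by (rule exI[of _ "mat 1"]) (simp add: dilation_word_1)
  next
    case (step z z')
    then obtain h where h: "dilation_word h" "z = matrix_pair (h ** B)" by blast
    with step.hyps(2) obtain g where "z' = matrix_pair (g ** (h ** B))"
      "\<And>h. dilation_word h \<Longrightarrow> dilation_word (g ** h)"
      by (auto elim: AC_move_matrix_pair)
    with h show ?case
      by (metis matrix_mul_assoc)
  qed
  then show ?thesis using that by blast
qed

section \<open>The pairs of the theorem\<close>

text \<open>This is (1 + k y N) diag(z, 1), where z is u as a constant series and y is s^-1; diag(z,
  1) represents the images of [x_1, x_2] and x_3.\<close>

definition step_matrix :: "int \<Rightarrow> int fps fls^2^2" where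
  "step_matrix k =
     (let z = fls_const fps_X; y = X_intpow (-1)
      in mat2 (z + 2 * of_int k * y * z ^ 2) (4 * of_int k * y)
           (- (of_int k * y * z ^ 3)) (1 - 2 * of_int k * y * z))"

lemma matrix_pair_step:
  fixes k :: int
  defines "s \<equiv> (1 + fls_const fps_X, 0, 0) :: int fps fls \<times> int fps fls \<times> int fps fls"
    and "t \<equiv> (X_intpow (-1), 1, 0)"
    and "a \<equiv> (1, fls_const fps_X, 0)" and "b \<equiv> (1, 0, 1)"
  assumes "laurent_unit (1 + fls_const fps_X :: int fps fls)"
  shows "matrix_pair (step_matrix k) = [step_fst affine_group s t k a b, step_snd affine_group s t k a b]"
  unfolding s_def t_def a_def b_def affine_step[OF assms(5) laurent_unit_X_intpow]
  by (simp add: matrix_pair_def step_matrix_def Let_def algebra_simps power2_eq_square power3_eq_cube)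

text \<open>As N^2 = 0, the inverse of 1 + k y N is 1 - k y N. So h is 1 + (l - k) y N, which
  \<open>not_dilation_word\<close> excludes for distinct k and l.\<close>

lemma step_matrix_inj:
  assumes "dilation_word h" "h ** step_matrix k = step_matrix l"
  shows "k = l"
proof (rule ccontr)
  assume "k \<noteq> l"
  define z y where "z = (fls_const fps_X :: int fps fls)" and "y = (X_intpow (-1) :: int fps fls)"
  have z: "z \<noteq> 0"
    by (simp add: z_def)
  define N :: "int fps^2^2" where "N = mat2 (2 * of_int (l - k) * fps_X) (4 * of_int (l - k))
     (- (of_int (l - k) * fps_X ^ 2)) (- (2 * of_int (l - k) * fps_X))"
  \<comment> \<open>Solves (u, v) \<open>step_matrix k\<close> = (c z, d) for the row (u, v): cancel
    z, which is nonzero but not a unit, and multiply by 1 - k y N from the right.\<close>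
  have cancel: "u = (c - 2 * of_int k * y * z * c) + of_int k * y * z ^ 2 * d"
      "v = (d + 2 * of_int k * y * z * d) - 4 * of_int k * y * c"
    if "u * (z + 2 * of_int k * y * z ^ 2) - v * (of_int k * y * z ^ 3) = c * z"
      "u * (4 * of_int k * y) + v * (1 - 2 * of_int k * y * z) = d" for u v c d
  proof -
    have "z * (u * (1 + 2 * of_int k * y * z) - v * (of_int k * y * z ^ 2)) = z * c"
      using that(1) by (simp add: algebra_simps power2_eq_square power3_eq_cube)
    then have c: "c = u * (1 + 2 * of_int k * y * z) - v * (of_int k * y * z ^ 2)"
      using z by simp
    show "u = (c - 2 * of_int k * y * z * c) + of_int k * y * z ^ 2 * d"
      unfolding c that(2)[symmetric] by (simp add: algebra_simps power2_eq_square)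
    show "v = (d + 2 * of_int k * y * z * d) - 4 * of_int k * y * c"
      unfolding c that(2)[symmetric] by (simp add: algebra_simps power2_eq_square)
  qed
  have eqs: "h$1$1 * (z + 2 * of_int k * y * z ^ 2) - h$1$2 * (of_int k * y * z ^ 3)
      = (1 + 2 * of_int l * y * z) * z"
    "h$1$1 * (4 * of_int k * y) + h$1$2 * (1 - 2 * of_int k * y * z) = 4 * of_int l * y"
    "h$2$1 * (z + 2 * of_int k * y * z ^ 2) - h$2$2 * (of_int k * y * z ^ 3)
      = - (of_int l * y * z ^ 2) * z"
    "h$2$1 * (4 * of_int k * y) + h$2$2 * (1 - 2 * of_int k * y * z) = 1 - 2 * of_int l * y * z"
    using assms(2)
    by (simp_all add: mat2_eq_iff mult_mat2_nth step_matrix_def Let_def flip: z_def y_def)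
      (simp_all add: algebra_simps power2_eq_square power3_eq_cube)
  have entries: "h$1$1 = 1 + y * (2 * of_int (l - k) * z)" "h$1$2 = y * (4 * of_int (l - k))"
    "h$2$1 = y * (- (of_int (l - k) * z ^ 2))" "h$2$2 = 1 + y * (- (2 * of_int (l - k) * z))"
    unfolding cancel(1)[OF eqs(1,2)] cancel(2)[OF eqs(1,2)] cancel(1)[OF eqs(3,4)] cancel(2)[OF eqs(3,4)]
    by (simp_all add: algebra_simps power2_eq_square)
  have "2 * of_int (l - k) * z = fls_const (N$1$1)" "4 * of_int (l - k) = fls_const (N$1$2)"
    "- (of_int (l - k) * z ^ 2) = fls_const (N$2$1)" "- (2 * of_int (l - k) * z) = fls_const (N$2$2)"
    by (simp_all only: N_def vector_2 z_def fls_of_int fls_const_uminus fls_const_power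
        fls_const_mult_const[symmetric] fls_const_numeral)
  from entries[unfolded this(4), unfolded this(1-3)]
  have "h = (\<chi> a b. (if a = b then 1 else 0) + X_intpow (-1) * fls_const (N$a$b))"
    by (simp add: mat2_eq_iff y_def)
  with not_dilation_word[of "l - k"] \<open>k \<noteq> l\<close> assms(1) show False
    by (simp add: N_def)
qed

text \<open>This keeps the pairs from collapsing to singletons. In the second column, the
  coefficient of s^0 is 0 in the first row and 1 in the second.\<close>

lemma step_matrix_rows: "(step_matrix k$1$1, step_matrix k$1$2) \<noteq> (step_matrix k$2$1, step_matrix k$2$2)"
proof
  assume "(step_matrix k$1$1, step_matrix k$1$2) = (step_matrix k$2$1, step_matrix k$2$2)"
  then have "X_intpow (-1) * (4 * of_int k :: int fps fls)
      = 1 - X_intpow (-1) * (2 * of_int k * fls_const fps_X)"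
    by (simp add: step_matrix_def Let_def ac_simps)
  moreover have "(4 * of_int k :: int fps fls) = fls_const (4 * of_int k)"
    "(2 * of_int k * fls_const fps_X :: int fps fls) = fls_const (2 * of_int k * fps_X)"
    by (simp_all only: fls_of_int fls_const_mult_const[symmetric] fls_const_numeral)
  ultimately have "X_intpow (-1) * fls_const (4 * of_int k :: int fps)
      = 1 - X_intpow (-1) * fls_const (2 * of_int k * fps_X)"
    by (simp only:)
  then have "fls_nth (X_intpow (-1) * fls_const (4 * of_int k :: int fps)) 0
      = fls_nth (1 - X_intpow (-1) * fls_const (2 * of_int k * fps_X)) 0"
    by (rule arg_cong)
  then show False
    by (simp add: X_intpow_mult_nth)
qed

section \<open>The homomorphism from M to affine maps\<close>

lemma laurent_unit_const:
  assumes "e dvd 1"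
  shows "laurent_unit (fls_const e)"
proof -
  from assms obtain f where "1 = e * f" by (auto simp: dvd_def)
  then have "1 = fps_const e * fps_const f" by simp
  then have "fps_const e dvd 1" by (rule dvdI)
  then show ?thesis
    unfolding laurent_unit_def by (intro exI[of _ 0] exI[of _ "fps_const e"]) simp
qed

text \<open>The generator x_1 acts by 1 + u, which has to be a unit; power series in u as
  coefficients provide this.\<close>

lemma laurent_unit_1_plus_z: "laurent_unit (1 + fls_const fps_X :: int fps fls)"
proof -
  have "fps_left_inverse (1 + fps_X) 1 * (1 + fps_X) = (1 :: int fps)"
    by (rule fps_left_inverse) simp
  then have "(1 + fps_X :: int fps) dvd 1"
    by (metis dvd_triv_right)
  from laurent_unit_const[OF this] show ?thesis
    by (simp flip: fls_const_1 fls_plus_const)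
qed

lemma (in group) commutator_eqI:
  assumes "a \<in> carrier G" "b \<in> carrier G" "c \<in> carrier G" "a \<otimes> b = c \<otimes> (b \<otimes> a)"
  shows "commutator G a b = c"
  unfolding commutator_def assms(4) using assms(1-3) by (simp add: m_assoc)

text \<open>Linear parts commute, so the commutator is a translation: 1 + u scales the translation
  part 1 of the second map, and the difference u remains.\<close>

lemma affine_commutator:
  "commutator affine_group (1 + fls_const fps_X, 0, 0) (X_intpow (-1), 1, 0)
    = (1, fls_const fps_X, 0 :: int fps fls)"
  by (rule affine.commutator_eqI) (simp_all add: laurent_unit_1_plus_z mult.commute add.commute)

lemma listings_doubleton:
  assumes "p \<noteq> q"
  shows "listings {p, q} = {[p, q], [q, p]}"
proof -
  have "a = [p, q] \<or> a = [q, p]" if a: "distinct a" "set a = {p, q}" for a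
  proof -
    have "length a = 2"
      using distinct_card[OF a(1)] a(2) assms by simp
    then obtain u v where "a = [u, v]"
      by (auto simp: length_Suc_conv numeral_2_eq_2)
    with a assms show ?thesis by auto
  qed
  with assms show ?thesis
    by (auto simp: listings_def)
qed

text \<open>Otherwise the simplifier rewrites \<open>{1..n}\<close>, and rules about \<open>free_group {1..n}\<close> no
  longer apply.\<close>

declare One_nat_def [simp del]

lemma quotient_to_affine_group:
  fixes n :: nat
  assumes n: "n \<ge> 3"
    and R_eq: "R = normal_closure (free_group {1..n})
      {commutator (free_group {1..n}) (gen 1) (gen 2), gen 3}"
  obtains \<psi> where "group_hom (quot_RR {1..n} R) affine_group \<psi>"
    "\<psi> (proj_RR {1..n} R (gen 1)) = (1 + fls_const fps_X, 0, 0)"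
    "\<psi> (proj_RR {1..n} R (gen 2)) = (X_intpow (-1), 1, 0)"
    "\<psi> (proj_RR {1..n} R (gen 3)) = (1, 0, 1 :: int fps fls)"
proof -
  let ?F = "free_group {1..n}"
  \<comment> \<open>The values send [x_1, x_2] and x_3 to the translations by (u, 0) and (0, 1);
    further generators act trivially.\<close>
  define h :: "nat \<Rightarrow> int fps fls \<times> int fps fls \<times> int fps fls" where
    "h = (\<lambda>i. if i = 1 then (1 + fls_const fps_X, 0, 0) else if i = 2 then (X_intpow (-1), 1, 0)
       else if i = 3 then (1, 0, 1) else (1, 0, 0))"
  have h_gen: "h 1 = (1 + fls_const fps_X, 0, 0)" "h 2 = (X_intpow (-1), 1, 0)" "h 3 = (1, 0, 1)"
    by (simp_all add: h_def)
  have h: "h i \<in> carrier affine_group" for i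
    by (simp add: h_def laurent_unit_1_plus_z)
  interpret \<phi>: group_hom ?F affine_group "free_group_lift affine_group h"
    by (rule affine.free_group_lift[OF h])
  have \<phi>_gen: "free_group_lift affine_group h (gen i) = h i" if "i \<in> {1..n}" for i
    by (rule affine.free_group_lift(2)[OF h that])
  have gens: "gen 1 \<in> carrier ?F" "gen 2 \<in> carrier ?F" "gen 3 \<in> carrier ?F"
    using n by simp_all
  then have sub: "{commutator ?F (gen 1) (gen 2), gen 3} \<subseteq> carrier ?F"
    by (simp add: commutator_def)
  interpret relation_quotient "{1..n}" R
    unfolding R_eq by (rule relation_quotient.intro, rule \<phi>.G.normal_normal_closure[OF sub])
  \<comment> \<open>The words acting as translations form a normal subgroup. It contains both
    relators, hence R, so the images of elements of R commute.\<close>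
  let ?N = "{w \<in> carrier ?F. \<exists>a b. free_group_lift affine_group h w = (1, a, b)}"
  have "subgroup ?N ?F"
  proof (rule \<phi>.G.subgroupI)
    show "?N \<noteq> {}"
      using \<phi>.G.one_closed by (auto intro!: exI[of _ "\<one>\<^bsub>?F\<^esub>"] simp del: \<phi>.G.one_closed)
  qed auto
  moreover have "g \<otimes>\<^bsub>?F\<^esub> w \<otimes>\<^bsub>?F\<^esub> inv\<^bsub>?F\<^esub> g \<in> ?N" if "g \<in> carrier ?F" "w \<in> ?N" for g w
  proof -
    obtain u c d where "free_group_lift affine_group h g = (u, c, d)"
      by (cases "free_group_lift affine_group h g")
    with that \<phi>.hom_closed[of g] show ?thesis
      by (auto simp: affine_conj simp del: affine_group_simps(2))
  qed
  ultimately have N: "?N \<lhd> ?F"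
    by (simp add: \<phi>.G.normal_inv_iff)
  have "{commutator ?F (gen 1) (gen 2), gen 3} \<subseteq> ?N"
    using gens n sub affine_commutator by (simp add: \<phi>.commutator_hom \<phi>_gen h_gen)
  then have "R \<subseteq> ?N"
    unfolding R_eq by (rule \<phi>.G.normal_closure_minimal[OF N])
  then have "free_group_lift affine_group h u \<otimes>\<^bsub>affine_group\<^esub> free_group_lift affine_group h v
    = free_group_lift affine_group h v \<otimes>\<^bsub>affine_group\<^esub> free_group_lift affine_group h u"
    if "u \<in> R" "v \<in> R" for u v
  proof -
    from that \<open>R \<subseteq> ?N\<close> obtain a b c d where
      "free_group_lift affine_group h u = (1, a, b)" "free_group_lift affine_group h v = (1, c, d)"
      by blast
    then show ?thesis by (simp add: add.commute)
  qed
  from quotient_lift[OF \<phi>.group_hom_axioms this] obtain \<psi> where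
    \<psi>: "group_hom (quot_RR {1..n} R) affine_group \<psi>"
    "\<And>w. w \<in> carrier ?F \<Longrightarrow> \<psi> (proj_RR {1..n} R w) = free_group_lift affine_group h w"
    by blast
  show thesis
    by (rule that[OF \<psi>(1)]) (use n in \<open>simp_all add: \<psi>(2) \<phi>_gen h_gen\<close>)
qed

theorem theorem1p6:
  fixes n :: nat
    and F :: "nat word monoid"
    and R :: "nat word set"
    and M :: "nat word set monoid"
    and x :: "nat \<Rightarrow> nat word set"
    and r p q :: "nat word set"
  assumes "n \<ge> 3"
    and "F = free_group {1..n}"
    and "R = normal_closure F {commutator F (gen 1) (gen 2), gen 3}"
    and "M = quot_RR {1..n} R"
    and "x = (\<lambda>i. proj_RR {1..n} R (gen i))"
    and "r = commutator M (x 1) (x 2)"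
    and "p = r \<otimes>\<^bsub>M\<^esub> conj_pow M (commutator M r (x 1)) (-2) (inv\<^bsub>M\<^esub> (x 2))
               \<otimes>\<^bsub>M\<^esub> conj_pow M (x 3) 4 (inv\<^bsub>M\<^esub> (x 2))"
    and "q = conj_pow M (commutator M (commutator M r (x 1)) (x 1)) (-1) (inv\<^bsub>M\<^esub> (x 2))
               \<otimes>\<^bsub>M\<^esub> x 3
               \<otimes>\<^bsub>M\<^esub> conj_pow M (commutator M (x 3) (x 1)) 2 (inv\<^bsub>M\<^esub> (x 2))"
  shows "(\<exists>\<S>. infinite \<S> \<and>
            (\<forall>A\<in>\<S>. A \<subseteq> carrier M \<and> card A = 2 \<and>
                   normal_closure M A = proj_RR {1..n} R ` R) \<and>
            (\<forall>A\<in>\<S>. \<forall>B\<in>\<S>. A \<noteq> B \<longrightarrow>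
               (\<forall>a\<in>listings A. \<forall>b\<in>listings B.
                  \<not> AC_equivalent M a b \<and> stably_AC_equivalent {1..n} R a b))) \<and>
         normal_closure M {p, q} = normal_closure M {r, x 3} \<and>
         \<not> AC_equivalent M [p, q] [r, x 3]"
proof -
  let ?S = "{1..n}"
  let ?\<pi> = "proj_RR ?S R"
  interpret F: group F
    unfolding assms(2) by (rule group_free_group)
  have gens: "gen 1 \<in> carrier F" "gen 2 \<in> carrier F" "gen 3 \<in> carrier F"
    using assms(1) by (simp_all add: assms(2))
  define c :: "nat word" where "c = commutator F (gen 1) (gen 2)"
  have sub: "{c, gen 3} \<subseteq> carrier F"
    using gens by (simp add: c_def commutator_def)
  have R_eq: "R = normal_closure F {c, gen 3}"
    unfolding assms(3) c_def ..
  have R_normal: "R \<lhd> F"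
    unfolding R_eq by (rule F.normal_normal_closure[OF sub])
  have in_R: "c \<in> R" "gen 3 \<in> R"
    using F.normal_closure_incl[of "{c, gen 3}"] by (simp_all add: R_eq)
  interpret Q: relation_quotient ?S R
    using R_normal by (simp add: relation_quotient_def assms(2))
  interpret proj: group_hom F M ?\<pi>
    unfolding assms(2,4) by (rule Q.proj.group_hom_axioms)
  interpret A: abelian_normal "?\<pi> ` R" M "x 1" "x 2"
    unfolding assms(4,5) by (rule Q.abelian_normal_proj) (use gens in \<open>simp_all add: assms(2)\<close>)
  have r: "r = ?\<pi> c"
    using gens by (simp add: assms(5,6) c_def proj.commutator_hom)
  have rA: "r \<in> ?\<pi> ` R" "x 3 \<in> ?\<pi> ` R"
    using in_R by (auto simp: r assms(5))
  \<comment> \<open>\<open>Pw k\<close> and \<open>Qw k\<close> are words representing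
    \<open>P k\<close> and \<open>Q k\<close>, as needed for adjoining a generator.\<close>
  define Pw where "Pw k = step_fst F (gen 1) (gen 2) k c (gen 3)" for k
  define Qw where "Qw k = step_snd F (gen 1) (gen 2) k c (gen 3)" for k
  define P where "P k = step_fst M (x 1) (x 2) k r (x 3)" for k
  define Q where "Q k = step_snd M (x 1) (x 2) k r (x 3)" for k
  have \<pi>: "?\<pi> (Pw k) = P k" "?\<pi> (Qw k) = Q k" for k
    using gens sub by (simp_all add: Pw_def Qw_def P_def Q_def proj.step_hom r assms(5))
  have w_in: "Pw k \<in> R" "Qw k \<in> R" for k
    unfolding Pw_def Qw_def using normal.step_in_normal[OF R_normal gens(1,2) in_R] by auto
  have PQ_A: "P k \<in> ?\<pi> ` R" "Q k \<in> ?\<pi> ` R" for k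
    using rA by (simp_all add: P_def Q_def A.step_in)
  then have PQ: "P k \<in> carrier M" "Q k \<in> carrier M" for k
    by simp_all
  \<comment> \<open>The pair of the theorem and Y are the members k = 1 and k = 0 of one family
    indexed by the integers.\<close>
  have pq: "p = P 1" "q = Q 1"
    unfolding assms(7,8) P_def Q_def using A.step_1[OF _ rA] rA by (simp_all flip: assms(6))
  have rx: "r = P 0" "x 3 = Q 0"
    using rA by (simp_all add: P_def Q_def A.step_0)
  have closure: "normal_closure M {P k, Q k} = normal_closure M {r, x 3}" for k
    unfolding P_def Q_def by (rule A.normal_closure_step[OF rA])
  have image: "normal_closure M {r, x 3} = ?\<pi> ` R"
    using proj.normal_closure_image[OF _ sub] Q.proj_surj
    by (simp add: R_eq r assms(5) assms(2,4))

  obtain \<psi> where \<psi>: "group_hom M affine_group \<psi>" "\<psi> (x 1) = (1 + fls_const fps_X, 0, 0)"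
    "\<psi> (x 2) = (X_intpow (-1), 1, 0)" "\<psi> (x 3) = (1, 0, 1 :: int fps fls)"
    using quotient_to_affine_group[OF assms(1) assms(3)[unfolded assms(2)]]
    unfolding assms(4,5) by blast
  interpret \<psi>: group_hom M affine_group \<psi> by (rule \<psi>(1))
  have "\<psi> r = (1, fls_const fps_X, 0)"
    unfolding assms(6) by (simp add: \<psi>.commutator_hom \<psi>(2,3) affine_commutator)
  then have pair: "map \<psi> [P k, Q k] = matrix_pair (step_matrix k)" for k
    using rA by (simp add: P_def Q_def \<psi>.step_hom \<psi>(2-4) matrix_pair_step[OF laurent_unit_1_plus_z])
  have inequivalent: "k = l" if "AC_equivalent M [P k, Q k] [P l, Q l]" for k l
  proof -
    have "AC_equivalent affine_group (matrix_pair (step_matrix k)) (matrix_pair (step_matrix l))"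
      using \<psi>.AC_equivalent_hom[OF that] PQ by (simp only: pair) simp
    then obtain h where "dilation_word h" "matrix_pair (step_matrix l) = matrix_pair (h ** step_matrix k)"
      by (rule AC_equivalent_matrix_pair)
    then show ?thesis
      by (intro step_matrix_inj[of h]) (simp_all add: matrix_pair_def mat2_eq_iff)
  qed
  have P_neq_Q: "P k \<noteq> Q k" for k
    using pair[of k] step_matrix_rows[of k] by (auto simp: matrix_pair_def)
  have listing: "AC_equivalent M a [P k, Q k]" "AC_equivalent M [P k, Q k] a"
    if "a \<in> listings {P k, Q k}" for a k
    using that PQ proj.H.AC_swap by (auto simp: listings_doubleton[OF P_neq_Q] AC_equivalent_refl)
  have stable: "stably_AC_equivalent ?S R [P k, Q k] [P l, Q l]" for k l
  proof -
    have w: "Pw k \<in> carrier F" "Qw k \<in> carrier F"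
      using w_in[of k] Q.R_closed by (simp_all add: assms(2))
    \<comment> \<open>The step by l - k on the words for k need not produce the words for l, but by
      \<open>step_step\<close> it gives the same elements of M.\<close>
    have "?\<pi> (step_fst F (gen 1) (gen 2) (l - k) (Pw k) (Qw k)) = P l"
      "?\<pi> (step_snd F (gen 1) (gen 2) (l - k) (Pw k) (Qw k)) = Q l"
      using A.step_step[OF rA, of "l - k" k] gens w
      by (simp_all add: proj.step_hom \<pi> P_def Q_def flip: assms(5)[THEN fun_cong])
    \<comment> \<open>The number 0 is free as a new generator, because those of F are numbered from
      1.\<close>
    then show ?thesis
      using Q.stably_AC_equivalent_step[of 0 "gen 1" "gen 2" "Pw k" "Qw k" "l - k"] gens w_in
      by (simp add: \<pi> assms(2))
  qed
  have stable_listing: "stably_AC_equivalent ?S R a b"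
    if "a \<in> listings {P k, Q k}" "b \<in> listings {P l, Q l}" for a b k l
    using stable_AC_of_AC[OF listing(1)[OF that(1), unfolded assms(4)]] stable[of k l]
      stable_AC_of_AC[OF listing(2)[OF that(2), unfolded assms(4)]]
    by (simp add: stably_AC_equivalent_def)
  have neq: "k = l"
    if "a \<in> listings {P k, Q k}" "b \<in> listings {P l, Q l}" "AC_equivalent M a b" for a b k l
  proof (rule inequivalent)
    show "AC_equivalent M [P k, Q k] [P l, Q l]"
      using listing(2)[OF that(1)] that(3) listing(1)[OF that(2)] AC_equivalent_trans by blast
  qed
  have "inj (\<lambda>k. {P k, Q k})"
  proof (rule injI)
    fix k l assume "{P k, Q k} = {P l, Q l}"
    moreover have "[P k, Q k] \<in> listings {P k, Q k}"
      by (simp add: listings_doubleton[OF P_neq_Q])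
    ultimately show "k = l"
      using neq[of "[P k, Q k]" k "[P k, Q k]" l] by (simp add: AC_equivalent_refl)
  qed
  then have inf: "infinite (range (\<lambda>k. {P k, Q k}))"
    using finite_imageD infinite_UNIV_int by blast
  show ?thesis
  proof (intro conjI exI[of _ "range (\<lambda>k. {P k, Q k})"])
    show "\<forall>A\<in>range (\<lambda>k. {P k, Q k}). A \<subseteq> carrier M \<and> card A = 2 \<and> normal_closure M A = ?\<pi> ` R"
      using PQ P_neq_Q by (simp add: closure image)
    show "\<forall>A\<in>range (\<lambda>k. {P k, Q k}). \<forall>B\<in>range (\<lambda>k. {P k, Q k}). A \<noteq> B \<longrightarrow>
        (\<forall>a\<in>listings A. \<forall>b\<in>listings B. \<not> AC_equivalent M a b \<and> stably_AC_equivalent ?S R a b)"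
      using neq stable_listing by blast
    show "\<not> AC_equivalent M [p, q] [r, x 3]"
      using inequivalent[of 1 0] unfolding pq rx by auto
  qed (use inf closure in \<open>simp_all add: pq\<close>)
qed

end
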